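(* Let $\mathcal{T}_n$ be the set of connected $(1,3)$-valent combinatorial maps with $n$ edges, namely pairs $(v,e)$ of permutations of the half-edge set $\{1,\dots,2n\}$ such that every cycle of $v$ has length $1$ or $3$, $e$ is a fixed-point-free involution, and $\langle v,e\rangle$ acts transitively. Let $X^{uni}_n$ be the number of $1$-valent vertices (fixed points of $v$) of a uniformly random element of $\mathcal{T}_n$. Then the mean $\mu_n$ and variance $\sigma_n^2$ of $X^{uni}_n$ satisfy $\mu_n \sim \sigma_n^2 \sim \sqrt[3]{2n}$, and $$\frac{X^{uni}_n - \sqrt[3]{2n}}{\sqrt{\sqrt[3]{2n}}} \xrightarrow{D} \mathcal{N}(0,1).$$
   Context: In a combinatorial map $(v,e)$, vertices are the cycles of $v$, and the degree of a vertex is the length of its cycle. Edges are the cycles of $e$. *)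

theory Defs
  imports
    "HOL-Probability.Probability"
    "HOL-Combinatorics.Orbits"
    "HOL-Algebra.Sym_Groups"
    "HOL-Library.Landau_Symbols"
begin

text \<open>
  A permutation of \<open>{1..2 * n}\<close> is a function on all of \<open>nat\<close> that fixes every point outside
  \<open>{1..2 * n}\<close>. A cycle is represented by its set of elements, so fixed points inside
  \<open>{1..2 * n}\<close> count as cycles of length 1.
\<close>

definition cycles_on :: "nat set \<Rightarrow> (nat \<Rightarrow> nat) \<Rightarrow> nat set set" where
  "cycles_on S p = Orbits.orbit p ` S"

text \<open>
  The condition that every cycle of \<open>e\<close> has length 2 is spelled out as: \<open>e\<close> is an involution
  without fixed points on the half-edges.
\<close>

definition combinatorial_map :: "nat \<Rightarrow> (nat \<Rightarrow> nat) \<times> (nat \<Rightarrow> nat) \<Rightarrow> bool" where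
  "combinatorial_map n = (\<lambda>(v, e). v permutes {1..2 * n} \<and> e permutes {1..2 * n} \<and>
     e \<circ> e = id \<and> (\<forall>x\<in>{1..2 * n}. e x \<noteq> x))"

definition connected_map :: "nat \<Rightarrow> (nat \<Rightarrow> nat) \<times> (nat \<Rightarrow> nat) \<Rightarrow> bool" where
  "connected_map n = (\<lambda>(v, e). \<forall>x\<in>{1..2 * n}. \<forall>y\<in>{1..2 * n}.
     \<exists>g\<in>generate (sym_group (2 * n)) {v, e}. g x = y)"

definition vertices :: "nat \<Rightarrow> (nat \<Rightarrow> nat) \<times> (nat \<Rightarrow> nat) \<Rightarrow> nat set set" where
  "vertices n = (\<lambda>(v, e). cycles_on {1..2 * n} v)"

definition one_three_valent :: "nat \<Rightarrow> (nat \<Rightarrow> nat) \<times> (nat \<Rightarrow> nat) \<Rightarrow> bool" where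
  "one_three_valent n m \<longleftrightarrow> (\<forall>c\<in>vertices n m. card c = 1 \<or> card c = 3)"

definition maps13 :: "nat \<Rightarrow> ((nat \<Rightarrow> nat) \<times> (nat \<Rightarrow> nat)) set" where
  "maps13 n = {m. combinatorial_map n m \<and> connected_map n m \<and> one_three_valent n m}"

definition num_univalent :: "nat \<Rightarrow> (nat \<Rightarrow> nat) \<times> (nat \<Rightarrow> nat) \<Rightarrow> nat" where
  "num_univalent n m = card {c \<in> vertices n m. card c = 1}"

text \<open>
  The set \<open>maps13 n\<close> is finite, and nonempty for every \<open>n\<close> (for odd \<open>n\<close> it contains trees, for
  even \<open>n > 0\<close> unicyclic maps, and for \<open>n = 0\<close> it is \<open>{(id, id)}\<close>), so \<open>pmf_of_set\<close> is
  the uniform distribution on it.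
\<close>

definition random_map13 :: "nat \<Rightarrow> ((nat \<Rightarrow> nat) \<times> (nat \<Rightarrow> nat)) pmf" where
  "random_map13 n = pmf_of_set (maps13 n)"

definition mean_univalent :: "nat \<Rightarrow> real" where
  "mean_univalent n =
     measure_pmf.expectation (random_map13 n) (\<lambda>m. real (num_univalent n m))"

definition var_univalent :: "nat \<Rightarrow> real" where
  "var_univalent n =
     measure_pmf.variance (random_map13 n) (\<lambda>m. real (num_univalent n m))"

end

theory Submission
  imports Defs "HOL-Real_Asymp.Real_Asymp"
begin

text \<open>
  Drop connectivity at first, so that \<open>v\<close> and \<open>e\<close> become independent and \<open>v\<close> is uniform among the
  permutations of \<open>N = 2 n\<close> points with \<open>v\<^sup>3 = id\<close>. Closing three marked fixed points up into a
  3-cycle gives \<open>E[X (X - 1) (X - 2) g(X)] = E[(N - X) g(X + 3)]\<close> for every \<open>g\<close>. This is a discrete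
  Stein equation: powers of \<open>X - 1 - \<kappa>\<close>, where \<open>\<kappa>\<close> is the cube root of \<open>N\<close>, give the moments up
  to order four, and exponentials give a perturbed version of the differential equation
  \<open>\<phi>'(t) = - t \<phi>(t)\<close> for the characteristic function.

  A pair \<open>(v, e)\<close> is disconnected iff it preserves a proper nonempty set. With \<open>a\<^sub>m\<close> the number of
  cubic permutations of \<open>m\<close> points, the union bound is the sum over \<open>1 \<le> j \<le> n / 2\<close> of
  \<open>(n choose j) a\<^bsub>2j\<^esub> a\<^bsub>2n-2j\<^esub> / a\<^bsub>2n\<^esub>\<close>. Since \<open>m a\<^bsub>m-1\<^esub> / a\<^sub>m\<close> is the mean number of fixed points, the
  mean estimate yields \<open>a\<^sub>m / a\<^bsub>m-1\<^esub> \<sim> m powr (2/3)\<close>, so up to subexponential factors the \<open>j\<close>-th term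
  is \<open>(n choose j) powr (-1/3)\<close> and the sum tends to 0. The fourth moment and the Cauchy-Schwarz
  inequality show that conditioning on connectedness does not change the first two moments either.
\<close>

section \<open>Cubic permutations and perfect matchings\<close>

text \<open>The cycle lengths 1 and 3 are the divisors of 3, so the valence condition becomes one
  equation. It may range over the whole type because \<open>v\<close> is the identity outside
  \<open>S\<close>.\<close>

definition cubic_perms :: "'a set \<Rightarrow> ('a \<Rightarrow> 'a) set" where
  "cubic_perms S = {v. v permutes S \<and> (\<forall>x. v (v (v x)) = x)}"

definition matchings :: "'a set \<Rightarrow> ('a \<Rightarrow> 'a) set" where
  "matchings S = {e. e permutes S \<and> e \<circ> e = id \<and> (\<forall>x\<in>S. e x \<noteq> x)}"

definition fixed_count :: "'a set \<Rightarrow> ('a \<Rightarrow> 'a) \<Rightarrow> nat" where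
  "fixed_count S v = card {x \<in> S. v x = x}"

lemma finite_cubic_perms: "finite S \<Longrightarrow> finite (cubic_perms S)"
  unfolding cubic_perms_def by (rule finite_subset[OF _ finite_permutations]) auto

lemma finite_matchings: "finite S \<Longrightarrow> finite (matchings S)"
  unfolding matchings_def by (rule finite_subset[OF _ finite_permutations]) auto

lemma id_in_cubic_perms: "id \<in> cubic_perms S"
  by (simp add: cubic_perms_def permutes_id)

lemma card_cubic_perms_pos: "finite S \<Longrightarrow> card (cubic_perms S) > 0"
  using id_in_cubic_perms finite_cubic_perms by (auto simp: card_gt_0_iff)

lemma fixed_count_le: "finite S \<Longrightarrow> fixed_count S v \<le> card S"
  unfolding fixed_count_def by (rule card_mono) auto

text \<open>Conjugation by a bijection from \<open>S\<close> to \<open>T\<close> is injective and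
  preserves the equation \<open>v (v (v x)) = x\<close>. Used in both directions it shows that the
  number depends only on the size of the set.\<close>

lemma card_cubic_perms_le:
  fixes S :: "'a set" and T :: "'b set"
  assumes "finite S" "finite T" "card S = card T"
  shows "card (cubic_perms S) \<le> card (cubic_perms T)"
proof -
  obtain f where f: "bij_betw f S T"
    using assms finite_same_card_bij by blast
  define F where "F = (\<lambda>v x. if x \<in> T then f (v (inv_into S f x)) else x)"
  have inj: "inj_on F {v. v permutes S}"
    using bij_betw_permutations[OF f] unfolding F_def bij_betw_def by blast
  have "F ` cubic_perms S \<subseteq> cubic_perms T"
  proof
    fix w assume "w \<in> F ` cubic_perms S"
    then obtain v where v: "v permutes S" "\<And>x. v (v (v x)) = x" "w = F v"
      by (auto simp: cubic_perms_def)
    have "w permutes T"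
      unfolding v F_def by (rule permutes_bij_inv_into[OF v(1) f])
    moreover have "w (w (w x)) = x" for x
    proof (cases "x \<in> T")
      case True
      have in_S: "inv_into S f y \<in> S" if "y \<in> T" for y
        using f that by (metis bij_betw_def inv_into_into)
      have left: "inv_into S f (f y) = y" if "y \<in> S" for y
        using f that by (simp add: bij_betw_inv_into_left)
      have vS: "v y \<in> S \<longleftrightarrow> y \<in> S" for y
        using v(1) by (rule permutes_in_image)
      have fT: "f y \<in> T" if "y \<in> S" for y
        using f that by (auto simp: bij_betw_def)
      show ?thesis
        unfolding v(3) F_def using True f
        by (simp add: in_S left vS fT v(2) bij_betw_inv_into_right)
    qed (simp add: v(3) F_def)
    ultimately show "w \<in> cubic_perms T" by (simp add: cubic_perms_def)
  qed
  moreover have "inj_on F (cubic_perms S)"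
    using inj by (rule inj_on_subset) (auto simp: cubic_perms_def)
  ultimately show ?thesis
    using assms(2) card_inj_on_le finite_cubic_perms by blast
qed

definition cubic_count :: "nat \<Rightarrow> nat" where
  "cubic_count m = card (cubic_perms {1..m})"

lemma card_cubic_perms: "finite S \<Longrightarrow> card (cubic_perms S) = cubic_count (card S)"
  unfolding cubic_count_def by (intro antisym card_cubic_perms_le) auto

lemma cubic_count_pos: "cubic_count m > 0"
  unfolding cubic_count_def by (rule card_cubic_perms_pos) simp

text \<open>Double counting of the pairs of a cubic permutation and one of its fixed points:
  deleting the fixed point \<open>x\<close> leaves a cubic permutation of \<open>S - {x}\<close>.
  This ties the mean number of fixed points to the ratio of consecutive counts.\<close>

lemma sum_fixed_count:
  assumes "finite S"
  shows "(\<Sum>v\<in>cubic_perms S. fixed_count S v) = card S * cubic_count (card S - 1)"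
proof -
  have "(\<Sum>v\<in>cubic_perms S. fixed_count S v) = (\<Sum>v\<in>cubic_perms S. \<Sum>x\<in>S. if v x = x then 1 else 0)"
    unfolding fixed_count_def using assms
    by (intro sum.cong refl) (simp add: sum.If_cases Int_def)
  also have "\<dots> = (\<Sum>x\<in>S. card {v \<in> cubic_perms S. v x = x})"
    by (subst sum.swap) (simp add: sum.If_cases Int_def finite_cubic_perms assms)
  also have "\<dots> = (\<Sum>x\<in>S. cubic_count (card S - 1))"
  proof (rule sum.cong[OF refl])
    fix x assume x: "x \<in> S"
    have "{v \<in> cubic_perms S. v x = x} = cubic_perms (S - {x})"
      using x by (auto simp: cubic_perms_def permutes_def)
    then show "card {v \<in> cubic_perms S. v x = x} = cubic_count (card S - 1)"
      using assms x by (simp add: card_cubic_perms)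
  qed
  finally show ?thesis by simp
qed

section \<open>Counting perfect matchings by the partner of a point\<close>

lemma card_matchings_insert2:
  fixes S :: "'a set"
  assumes "finite S" "x \<in> S"
  shows "card (matchings S) = (\<Sum>y\<in>S - {x}. card (matchings (S - {x, y})))"
proof -
  \<comment> \<open>\<open>G y\<close> adds the edge between \<open>x\<close> and \<open>y\<close>
    to a matching of the other points; turning \<open>x\<close> and \<open>y\<close> back into fixed
    points undoes it.\<close>
  define G where "G y e = e(x := y, y := x)" for y and e :: "'a \<Rightarrow> 'a"
  have part: "matchings S = (\<Union>y\<in>S - {x}. {e \<in> matchings S. e x = y})"
    using assms(2) by (auto simp: matchings_def permutes_in_image)
  have bij: "bij_betw (G y) (matchings (S - {x, y})) {e \<in> matchings S. e x = y}"
    if y: "y \<in> S - {x}" for y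
  proof (rule bij_betwI[where g = "\<lambda>e. e(x := x, y := y)"])
    show "G y \<in> matchings (S - {x, y}) \<rightarrow> {e \<in> matchings S. e x = y}"
    proof
      fix e assume e: "e \<in> matchings (S - {x, y})"
      then have p: "e permutes S - {x, y}" and ee: "\<And>z. e (e z) = z"
        and nf: "\<And>z. z \<in> S - {x, y} \<Longrightarrow> e z \<noteq> z"
        by (auto simp: matchings_def fun_eq_iff)
      have exy: "e x = x" "e y = y"
        using p by (auto simp: permutes_def)
      have ne: "e z \<noteq> x" "e z \<noteq> y" if "z \<noteq> x" "z \<noteq> y" for z
        using ee exy that by metis+
      have inv: "G y e (G y e z) = z" for z
        using y ne ee by (auto simp: G_def)
      have "G y e permutes S"
        unfolding permutes_def
      proof (intro conjI allI impI)
        fix z assume "z \<notin> S"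
        then show "G y e z = z"
          using y assms p by (auto simp: G_def permutes_def)
      next
        fix w show "\<exists>!z. G y e z = w"
          using inv by metis
      qed
      moreover have "\<forall>z\<in>S. G y e z \<noteq> z"
        using y nf by (auto simp: G_def)
      ultimately show "G y e \<in> {e \<in> matchings S. e x = y}"
        using inv y by (auto simp: matchings_def fun_eq_iff G_def)
    qed
  next
    show "(\<lambda>e. e(x := x, y := y)) \<in> {e \<in> matchings S. e x = y} \<rightarrow> matchings (S - {x, y})"
    proof
      fix e assume e: "e \<in> {e \<in> matchings S. e x = y}"
      then have p: "e permutes S" and ee': "e \<circ> e = id"
        and nf: "\<And>z. z \<in> S \<Longrightarrow> e z \<noteq> z" and ex: "e x = y"
        by (simp_all add: matchings_def)
      have ee: "e (e z) = z" for z
        using ee' by (metis comp_apply id_apply)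
      have exy: "e x = y" "e y = x"
        using ex ee[of x] by simp_all
      let ?h = "e(x := x, y := y)"
      have ne: "e z \<noteq> x" "e z \<noteq> y" if "z \<noteq> x" "z \<noteq> y" for z
        using ee exy that by metis+
      have inv: "?h (?h z) = z" for z
        using y ne ee by auto
      have "?h permutes S - {x, y}"
        unfolding permutes_def
      proof (intro conjI allI impI)
        fix z assume "z \<notin> S - {x, y}"
        then show "?h z = z"
          using p by (auto simp: permutes_def)
      next
        fix w show "\<exists>!z. ?h z = w"
          using inv by metis
      qed
      then show "?h \<in> matchings (S - {x, y})"
        using inv nf by (auto simp: matchings_def fun_eq_iff)
    qed
  next
    fix e assume "e \<in> matchings (S - {x, y})"
    then have "e permutes S - {x, y}" by (simp add: matchings_def)
    then show "(G y e)(x := x, y := y) = e"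
      by (auto simp: G_def permutes_def fun_eq_iff)
  next
    fix e assume e: "e \<in> {e \<in> matchings S. e x = y}"
    then have exy: "e x = y" and "e \<circ> e = id"
      by (simp_all add: matchings_def)
    then have "e y = x"
      by (metis comp_apply id_apply)
    with exy show "G y (e(x := x, y := y)) = e"
      by (auto simp: G_def fun_eq_iff)
  qed
  have fin: "finite {e \<in> matchings S. e x = y}" for y
    using finite_matchings[OF assms(1)] by simp
  have "card (matchings S) = (\<Sum>y\<in>S - {x}. card {e \<in> matchings S. e x = y})"
    unfolding part[THEN arg_cong[where f = card]]
    using assms(1) fin by (intro card_UN_disjoint) auto
  also have "\<dots> = (\<Sum>y\<in>S - {x}. card (matchings (S - {x, y})))"
    by (intro sum.cong refl bij_betw_same_card[OF bij, symmetric])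
  finally show ?thesis .
qed

lemma matchings_empty: "matchings {} = {id}"
  by (auto simp: matchings_def)

text \<open>This is the double factorial of \<open>2 * n - 1\<close> in a form without division. In
  the induction step \<open>x\<close> has \<open>2 * n + 1\<close> possible partners.\<close>

lemma card_matchings_even:
  assumes "finite S" "card S = 2 * n"
  shows "card (matchings S) * (2 ^ n * fact n) = fact (2 * n)"
  using assms
proof (induction n arbitrary: S)
  case 0
  then show ?case by (simp add: matchings_empty)
next
  case (Suc n)
  then obtain x where x: "x \<in> S" by fastforce
  have "card (matchings S) * (2 ^ Suc n * fact (Suc n)) =
      (\<Sum>y\<in>S - {x}. (card (matchings (S - {x, y})) * (2 ^ n * fact n)) * (2 * Suc n))"
    unfolding card_matchings_insert2[OF Suc.prems(1) x] sum_distrib_right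
    by (intro sum.cong refl) (simp add: algebra_simps)
  also have "\<dots> = (\<Sum>y\<in>S - {x}. fact (2 * n) * (2 * Suc n))"
  proof (rule sum.cong[OF refl])
    fix y assume y: "y \<in> S - {x}"
    have "card (S - {x, y}) = 2 * n"
      using Suc.prems x y by (auto simp: card_Diff_subset)
    then show "(card (matchings (S - {x, y})) * (2 ^ n * fact n)) * (2 * Suc n)
        = fact (2 * n) * (2 * Suc n)"
      using Suc.IH[of "S - {x, y}"] Suc.prems(1) by simp
  qed
  also have "\<dots> = (2 * n + 1) * (fact (2 * n) * (2 * Suc n))"
    using Suc.prems x by simp
  also have "\<dots> = fact (2 * Suc n)"
    by (simp add: algebra_simps)
  finally show ?case .
qed

text \<open>Removing a point and its partner keeps the parity, and a single point has no partner at
  all.\<close>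

lemma matchings_odd:
  assumes "finite S" "odd (card S)"
  shows "matchings S = {}"
  using assms
proof (induction "card S" arbitrary: S rule: less_induct)
  case less
  then obtain x where x: "x \<in> S" by fastforce
  have "card (matchings (S - {x, y})) = 0" if y: "y \<in> S - {x}" for y
  proof -
    have "card (S - {x, y}) = card S - 2" "card S \<ge> 2"
      using less.prems x y card_mono[of S "{x, y}"] by (auto simp: card_Diff_subset)
    then show ?thesis
      using less.hyps[of "S - {x, y}"] less.prems by simp
  qed
  then have "card (matchings S) = 0"
    by (subst card_matchings_insert2[OF less.prems(1) x]) simp
  then show ?case using finite_matchings[OF less.prems(1)] by simp
qed

lemma card_matchings_pos:
  assumes "finite S" "even (card S)"
  shows "card (matchings S) > 0"
proof -
  obtain n where "card S = 2 * n" using assms(2) by blast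
  from card_matchings_even[OF assms(1) this] show ?thesis
    by (metis fact_nonzero mult_0 neq0_conv)
qed

text \<open>The left side sums over permutations with an ordered triple of distinct fixed points,
  the right side over permutations with a marked point that is not fixed. Closing the triple into a
  3-cycle and marking its first point is a bijection that lowers the number of fixed points by
  three.\<close>

lemma sum_cubic_perms_exchange:
  fixes g :: "nat \<Rightarrow> 'b::comm_ring_1"
  assumes "finite S"
  shows "(\<Sum>v\<in>cubic_perms S. of_nat (fixed_count S v * (fixed_count S v - 1) * (fixed_count S v - 2)) *
            g (fixed_count S v))
       = (\<Sum>v\<in>cubic_perms S. of_nat (card S - fixed_count S v) * g (fixed_count S v + 3))"
proof -
  define F where "F v = {x \<in> S. v x = x}" for v :: "'a \<Rightarrow> 'a"
  define Tr where "Tr v = (SIGMA a:F v. SIGMA b:F v - {a}. F v - {a, b})" for v :: "'a \<Rightarrow> 'a"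
  have fF: "finite (F v)" and cF: "card (F v) = fixed_count S v" for v
    using assms by (auto simp: F_def fixed_count_def)
  have cTr: "card (Tr v) = fixed_count S v * (fixed_count S v - 1) * (fixed_count S v - 2)" for v
  proof -
    have "card (F v - {a, b}) = fixed_count S v - 2" if "a \<in> F v" "b \<in> F v - {a}" for a b
      using that fF[of v] cF[of v] by (subst card_Diff_subset) auto
    then show ?thesis
      unfolding Tr_def using fF[of v] cF[of v] by (simp add: card_SigmaI)
  qed
  have fTr: "finite (Tr v)" for v
    unfolding Tr_def using fF by auto
  have cG: "card (S - F v) = card S - fixed_count S v" for v
    using assms cF[of v] fF[of v] by (subst card_Diff_subset) (auto simp: F_def)
  have fC: "finite (cubic_perms S)" by (rule finite_cubic_perms[OF assms])
  have "(\<Sum>v\<in>cubic_perms S. of_nat (fixed_count S v * (fixed_count S v - 1) * (fixed_count S v - 2)) *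
            g (fixed_count S v)) = (\<Sum>v\<in>cubic_perms S. \<Sum>t\<in>Tr v. g (fixed_count S v))"
    by (subst cTr[symmetric]) simp
  also have "\<dots> = (\<Sum>(v, t)\<in>Sigma (cubic_perms S) Tr. g (fixed_count S v))"
    using fC fTr by (subst sum.Sigma) auto
  also have "\<dots> = (\<Sum>(v, a)\<in>(SIGMA v:cubic_perms S. S - F v). g (fixed_count S v + 3))"
  \<comment> \<open>\<open>j\<close> closes \<open>a\<close>, \<open>b\<close>, \<open>c\<close>
    into a cycle and remembers \<open>a\<close>; \<open>i\<close> turns the three points of the
    cycle through \<open>a\<close> into fixed points and lists them in cyclic order.\<close>
  proof (rule sum.reindex_bij_witness[where
        j = "\<lambda>(v, a, b, c). (v(a := b, b := c, c := a), a)" and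
        i = "\<lambda>(v, a). (v(a := a, v a := v a, v (v a) := v (v a)), a, v a, v (v a))"])
    fix p assume "p \<in> Sigma (cubic_perms S) Tr"
    then obtain v a b c where p: "p = (v, a, b, c)" and v: "v \<in> cubic_perms S"
      and abc: "a \<in> S" "b \<in> S" "c \<in> S" "v a = a" "v b = b" "v c = c" "b \<noteq> a" "c \<noteq> a" "c \<noteq> b"
      by (auto simp: Tr_def F_def)
    let ?w = "v(a := b, b := c, c := a)"
    have vvv: "v (v (v x)) = x" for x
      using v by (simp add: cubic_perms_def)
    \<comment> \<open>Since \<open>v\<close> has order dividing 3 and fixes \<open>a\<close>,
      \<open>b\<close>, \<open>c\<close>, it cannot send any other point to them; the new cycle is
      therefore separate from the old ones.\<close>
    have ne: "v x \<noteq> a" "v x \<noteq> b" "v x \<noteq> c" if "x \<notin> {a, b, c}" for x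
      using that abc vvv by (metis insertCI)+
    have www: "?w (?w (?w x)) = x" for x
    proof (cases "x \<in> {a, b, c}")
      case False
      then have vx: "v x \<notin> {a, b, c}" using ne[of x] by simp
      then have "v (v x) \<notin> {a, b, c}" using ne[of "v x"] by simp
      with vx False show ?thesis using vvv[of x] by simp
    qed (use abc in auto)
    have "?w permutes S"
      unfolding permutes_def
    proof (intro conjI allI impI)
      fix x assume "x \<notin> S"
      then show "?w x = x" using abc v by (auto simp: cubic_perms_def permutes_def)
    next
      fix y show "\<exists>!x. ?w x = y" using www by metis
    qed
    then have w: "?w \<in> cubic_perms S" using www by (simp only: cubic_perms_def mem_Collect_eq) blast
    show "(case case p of (v, a, b, c) \<Rightarrow> (v(a := b, b := c, c := a), a) of
        (v, a) \<Rightarrow> (v(a := a, v a := v a, v (v a) := v (v a)), a, v a, v (v a))) = p"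
      using abc by (auto simp: p fun_eq_iff)
    show "(case p of (v, a, b, c) \<Rightarrow> (v(a := b, b := c, c := a), a)) \<in> (SIGMA v:cubic_perms S. S - F v)"
      using w abc by (auto simp: p F_def simp del: fun_upd_apply) (auto)
    have "F v = insert a (insert b (insert c (F ?w)))" "a \<notin> F ?w" "b \<notin> F ?w" "c \<notin> F ?w"
      using abc by (auto simp: F_def)
    then have "fixed_count S v = fixed_count S ?w + 3"
      using abc fF[of ?w] by (simp add: cF[symmetric])
    then show "(case case p of (v, a, b, c) \<Rightarrow> (v(a := b, b := c, c := a), a) of
         (v, a) \<Rightarrow> g (fixed_count S v + 3)) = (case p of (v, t) \<Rightarrow> g (fixed_count S v))"
      by (simp add: p)
  next
    fix q assume "q \<in> (SIGMA v:cubic_perms S. S - F v)"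
    then obtain v a where q: "q = (v, a)" and v: "v \<in> cubic_perms S" and a: "a \<in> S" "v a \<noteq> a"
      by (auto simp: F_def)
    have vvv: "v (v (v x)) = x" for x
      using v by (simp add: cubic_perms_def)
    define b where "b = v a"
    define c where "c = v b"
    have vabc: "v a = b" "v b = c" "v c = a"
      by (simp_all add: b_def c_def vvv)
    have dist: "b \<noteq> a" "c \<noteq> a" "c \<noteq> b"
      using a vabc by metis+
    have inS: "b \<in> S" "c \<in> S"
      using a v by (auto simp: b_def c_def cubic_perms_def permutes_in_image)
    let ?w = "v(a := a, b := b, c := c)"
    have ne: "v x \<noteq> a" "v x \<noteq> b" "v x \<noteq> c" if "x \<notin> {a, b, c}" for x
      using that vabc vvv by (metis insertCI)+
    have www: "?w (?w (?w x)) = x" for x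
    proof (cases "x \<in> {a, b, c}")
      case False
      then have vx: "v x \<notin> {a, b, c}" using ne[of x] by simp
      then have "v (v x) \<notin> {a, b, c}" using ne[of "v x"] by simp
      with vx False show ?thesis using vvv[of x] by simp
    qed (use dist in auto)
    have "?w permutes S"
      unfolding permutes_def
    proof (intro conjI allI impI)
      fix x assume "x \<notin> S"
      then show "?w x = x" using v by (auto simp: cubic_perms_def permutes_def)
    next
      fix y show "\<exists>!x. ?w x = y" using www by metis
    qed
    then have w: "?w \<in> cubic_perms S" using www by (simp only: cubic_perms_def mem_Collect_eq) blast
    have qi: "(case q of (v, a) \<Rightarrow> (v(a := a, v a := v a, v (v a) := v (v a)), a, v a, v (v a)))
        = (?w, a, b, c)"
      by (simp add: q vabc)
    show "(case (case q of (v, a) \<Rightarrow> (v(a := a, v a := v a, v (v a) := v (v a)), a, v a, v (v a))) of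
        (v, a, b, c) \<Rightarrow> (v(a := b, b := c, c := a), a)) = q"
      unfolding qi using dist vabc by (auto simp: q fun_eq_iff)
    show "(case q of (v, a) \<Rightarrow> (v(a := a, v a := v a, v (v a) := v (v a)), a, v a, v (v a)))
        \<in> Sigma (cubic_perms S) Tr"
      unfolding qi using dist a inS w by (auto simp: Tr_def F_def)
  qed
  also have "\<dots> = (\<Sum>v\<in>cubic_perms S. \<Sum>a\<in>S - F v. g (fixed_count S v + 3))"
    using fC assms by (subst sum.Sigma) auto
  also have "\<dots> = (\<Sum>v\<in>cubic_perms S. of_nat (card S - fixed_count S v) * g (fixed_count S v + 3))"
    by (simp add: cG)
  finally show ?thesis .
qed

section \<open>Disconnected pairs\<close>

definition matching_count :: "nat \<Rightarrow> nat" where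
  "matching_count m = card (matchings {1..m})"

text \<open>The closed formula settles even sizes and both sides vanish for odd ones.\<close>

lemma card_matchings:
  assumes "finite S"
  shows "card (matchings S) = matching_count (card S)"
proof (cases "even (card S)")
  case True
  then obtain n where n: "card S = 2 * n" by blast
  have "card (matchings S) * (2 ^ n * fact n) = card (matchings {1..card S}) * (2 ^ n * fact n)"
    using card_matchings_even[OF assms n] card_matchings_even[of "{1..card S}" n] n by simp
  then show ?thesis by (simp add: matching_count_def)
next
  case False
  then show ?thesis
    using matchings_odd[OF assms] matchings_odd[of "{1..card S}"] by (simp add: matching_count_def)
qed

lemma matching_count_even: "matching_count (2 * n) * (2 ^ n * fact n) = fact (2 * n)"
  unfolding matching_count_def by (rule card_matchings_even) auto

lemma matching_count_odd: "odd m \<Longrightarrow> matching_count m = 0"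
  unfolding matching_count_def by (subst matchings_odd) auto

lemma matching_count_pos: "matching_count (2 * n) > 0"
  unfolding matching_count_def by (rule card_matchings_pos) auto

text \<open>A matching of \<open>2 * n\<close> points with \<open>j\<close> marked edges amounts to
  a set of \<open>2 * j\<close> points with a matching of it and one of its complement. The proof
  checks this with the factorial formula over the reals.\<close>

lemma matching_count_split:
  assumes "j \<le> n"
  shows "((2 * n) choose (2 * j)) * matching_count (2 * j) * matching_count (2 * n - 2 * j)
       = (n choose j) * matching_count (2 * n)"
proof -
  let ?m = "\<lambda>k. real (matching_count (2 * k))"
  have m: "?m k = fact (2 * k) / (2 ^ k * fact k)" for k
    using arg_cong[OF matching_count_even[of k], of real] by (simp add: field_simps)
  have b: "real ((2 * n) choose (2 * j)) = fact (2 * n) / (fact (2 * j) * fact (2 * (n - j)))"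
    using assms by (subst binomial_fact) (auto simp: diff_mult_distrib2)
  have "(2::real) ^ n = 2 ^ j * 2 ^ (n - j)"
    using assms by (simp flip: power_add)
  then have "real ((2 * n) choose (2 * j)) * ?m j * ?m (n - j) = real (n choose j) * ?m n"
    unfolding m b binomial_fact[OF assms] by (simp add: field_simps)
  then show ?thesis
    by (simp only: flip: of_nat_mult diff_mult_distrib2 of_nat_eq_iff)
qed

section \<open>Splitting a permutation along an invariant set\<close>

definition restrict_perm :: "'a set \<Rightarrow> ('a \<Rightarrow> 'a) \<Rightarrow> 'a \<Rightarrow> 'a" where
  "restrict_perm T v = (\<lambda>x. if x \<in> T then v x else x)"

lemma restrict_perm_permutes:
  assumes "v permutes S" "v ` T = T"
  shows "restrict_perm T v permutes T"
proof (rule bij_imp_permutes)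
  have "bij_betw v T T"
    using assms permutes_inj_on[OF assms(1), of T] by (simp add: bij_betw_def)
  then show "bij_betw (restrict_perm T v) T T"
    by (rule bij_betw_cong[THEN iffD1, rotated]) (simp add: restrict_perm_def)
qed (simp add: restrict_perm_def)

lemma restrict_perm_cubic:
  assumes "v \<in> cubic_perms S" "v ` T = T"
  shows "restrict_perm T v \<in> cubic_perms T"
proof -
  have "v x \<in> T" if "x \<in> T" for x using assms(2) that by blast
  then have "restrict_perm T v (restrict_perm T v (restrict_perm T v x)) = x" for x
    using assms(1) by (simp add: restrict_perm_def cubic_perms_def)
  then show ?thesis
    using assms restrict_perm_permutes[of v S T] by (simp add: cubic_perms_def)
qed

lemma restrict_perm_matching:
  assumes "e \<in> matchings S" "e ` T = T" "T \<subseteq> S"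
  shows "restrict_perm T e \<in> matchings T"
proof -
  have "e x \<in> T" if "x \<in> T" for x using assms(2) that by blast
  moreover have "e (e x) = x" for x
    using assms(1) by (simp add: matchings_def fun_eq_iff)
  ultimately have "restrict_perm T e \<circ> restrict_perm T e = id"
    by (simp add: restrict_perm_def fun_eq_iff)
  then show ?thesis
    using assms restrict_perm_permutes[of e S T]
    by (auto simp: matchings_def restrict_perm_def)
qed

lemma restrict_perm_inj:
  "inj_on (\<lambda>v. (restrict_perm T v, restrict_perm (S - T) v)) {v. v permutes S}"
proof (rule inj_onI)
  fix v w assume vw: "v \<in> {v. v permutes S}" "w \<in> {v. v permutes S}"
    "(restrict_perm T v, restrict_perm (S - T) v) = (restrict_perm T w, restrict_perm (S - T) w)"
  show "v = w"
  proof
    fix x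
    from vw(3) have "restrict_perm T v x = restrict_perm T w x"
      "restrict_perm (S - T) v x = restrict_perm (S - T) w x" by simp_all
    with vw(1,2) show "v x = w x"
      by (cases "x \<in> T"; cases "x \<in> S") (auto simp: restrict_perm_def permutes_def)
  qed
qed

lemma image_Diff_stable:
  assumes "v permutes S" "v ` T = T"
  shows "v ` (S - T) = S - T"
  using assms by (simp add: image_set_diff permutes_inj permutes_image)

text \<open>A permutation that preserves \<open>T\<close> is determined by its restrictions to
  \<open>T\<close> and \<open>S - T\<close>, which are again cubic. An injection suffices for the
  union bound.\<close>

lemma card_stable_cubic_perms_le:
  assumes "finite S" "T \<subseteq> S"
  shows "card {v \<in> cubic_perms S. v ` T = T} \<le> cubic_count (card T) * cubic_count (card S - card T)"
proof -
  let ?f = "\<lambda>v. (restrict_perm T v, restrict_perm (S - T) v)"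
  have fin: "finite T" "finite (S - T)" using assms finite_subset by auto
  have "?f ` {v \<in> cubic_perms S. v ` T = T} \<subseteq> cubic_perms T \<times> cubic_perms (S - T)"
    using restrict_perm_cubic image_Diff_stable by (fastforce simp: cubic_perms_def)
  moreover have "inj_on ?f {v \<in> cubic_perms S. v ` T = T}"
    by (rule inj_on_subset[OF restrict_perm_inj]) (auto simp: cubic_perms_def)
  ultimately have "card {v \<in> cubic_perms S. v ` T = T} \<le> card (cubic_perms T \<times> cubic_perms (S - T))"
    using fin by (intro card_inj_on_le) (auto intro: finite_cubic_perms)
  then show ?thesis
    using assms fin by (simp add: card_cubic_perms card_cartesian_product card_Diff_subset)
qed

lemma card_stable_matchings_le:
  assumes "finite S" "T \<subseteq> S"
  shows "card {e \<in> matchings S. e ` T = T} \<le> matching_count (card T) * matching_count (card S - card T)"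
proof -
  let ?f = "\<lambda>v. (restrict_perm T v, restrict_perm (S - T) v)"
  have fin: "finite T" "finite (S - T)" using assms finite_subset by auto
  have "?f ` {v \<in> matchings S. v ` T = T} \<subseteq> matchings T \<times> matchings (S - T)"
  proof
    fix q assume "q \<in> ?f ` {v \<in> matchings S. v ` T = T}"
    then obtain v where v: "q = ?f v" "v \<in> matchings S" "v ` T = T" by blast
    then have "v ` (S - T) = S - T"
      by (intro image_Diff_stable) (auto simp: matchings_def)
    with v assms(2) show "q \<in> matchings T \<times> matchings (S - T)"
      by (auto intro: restrict_perm_matching)
  qed
  moreover have "inj_on ?f {v \<in> matchings S. v ` T = T}"
    by (rule inj_on_subset[OF restrict_perm_inj]) (auto simp: matchings_def)
  ultimately have "card {v \<in> matchings S. v ` T = T} \<le> card (matchings T \<times> matchings (S - T))"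
    using fin by (intro card_inj_on_le) (auto intro: finite_matchings)
  then show ?thesis
    using assms fin by (simp add: card_matchings card_cartesian_product card_Diff_subset)
qed

section \<open>From combinatorial maps to pairs of permutations\<close>

lemma cycle_card_1_or_3_iff:
  assumes "v permutes S" "finite S"
  shows "card (Orbits.orbit v x) = 1 \<or> card (Orbits.orbit v x) = 3 \<longleftrightarrow> v (v (v x)) = x"
proof
  have self: "x \<in> Orbits.orbit v x"
    using assms by (intro permutation_self_in_orbit) (auto simp: permutation_permutes)
  \<comment> \<open>The size of the cycle is the first return time \<open>d\<close>; if it is 1 or
    3, the third iterate returns to \<open>x\<close>.\<close>
  define d where "d = funpow_dist1 v x x"
  have "card (Orbits.orbit v x) = d"
    unfolding d_def using inj_on_funpow_dist1[OF self]
    by (subst orbit_conv_funpow_dist1[OF self]) (simp add: card_image)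
  moreover have "(v ^^ d) x = x"
    unfolding d_def by (rule funpow_dist1_prop[OF self])
  ultimately show "v (v (v x)) = x" if "card (Orbits.orbit v x) = 1 \<or> card (Orbits.orbit v x) = 3"
    using that by (auto simp: numeral_3_eq_3)
next
  assume v3: "v (v (v x)) = x"
  then have "(v ^^ 3) x = x" by (simp add: numeral_3_eq_3)
  then have "Orbits.orbit v x = {(v ^^ m) x | m. m < 3}"
    by (rule orbit_altdef_bounded) simp
  also have "\<dots> = {x, v x, v (v x)}"
  proof -
    have "{(v ^^ m) x | m. m < 3} = (\<lambda>m. (v ^^ m) x) ` {..<3}" by auto
    also have "\<dots> = {x, v x, v (v x)}"
      by (simp add: numeral_3_eq_3 lessThan_Suc insert_commute)
    finally show ?thesis .
  qed
  finally have orb: "Orbits.orbit v x = {x, v x, v (v x)}" .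
  show "card (Orbits.orbit v x) = 1 \<or> card (Orbits.orbit v x) = 3"
  proof (cases "v x = x")
    case True
    then show ?thesis by (simp add: orb)
  next
    case False
    \<comment> \<open>If \<open>v\<close> moves \<open>x\<close>, a coincidence among the three
      points would contradict \<open>v3\<close>, so the orbit has exactly three elements.\<close>
    with v3 have "v (v x) \<noteq> x" "v (v x) \<noteq> v x" by metis+
    with False show ?thesis by (simp add: orb)
  qed
qed

definition all_pairs :: "nat \<Rightarrow> ((nat \<Rightarrow> nat) \<times> (nat \<Rightarrow> nat)) set" where
  "all_pairs n = cubic_perms {1..2 * n} \<times> matchings {1..2 * n}"

text \<open>Valence becomes a condition on \<open>v\<close> alone and the matching condition one on
  \<open>e\<close> alone; connectivity is the only condition that couples the two.\<close>

lemma maps13_eq: "maps13 n = {m \<in> all_pairs n. connected_map n m}"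
proof -
  have "one_three_valent n (v, e) \<longleftrightarrow> (\<forall>x. v (v (v x)) = x)" if v: "v permutes {1..2 * n}" for v e
  proof -
    have "one_three_valent n (v, e) \<longleftrightarrow> (\<forall>x\<in>{1..2 * n}. v (v (v x)) = x)"
      using cycle_card_1_or_3_iff[OF v] by (simp add: one_three_valent_def vertices_def cycles_on_def)
    also have "\<dots> \<longleftrightarrow> (\<forall>x. v (v (v x)) = x)"
      using v by (metis permutes_def)
    finally show ?thesis .
  qed
  then show ?thesis
    by (auto simp: maps13_def all_pairs_def combinatorial_map_def cubic_perms_def matchings_def)
qed

lemma num_univalent_eq: "num_univalent n (v, e) = fixed_count {1..2 * n} v"
  if "v permutes {1..2 * n}"
proof -
  have self: "x \<in> Orbits.orbit v x" for x
    using that by (intro permutation_self_in_orbit) (auto simp: permutation_permutes)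
  have sing: "card (Orbits.orbit v x) = 1 \<longleftrightarrow> v x = x" for x
    using self[of x] orbit_eq_singleton_iff[of v x] by (auto simp: card_1_singleton_iff)
  have "{c \<in> vertices n (v, e). card c = 1} = (\<lambda>x. {x}) ` {x \<in> {1..2 * n}. v x = x}"
  proof -
    have "{c \<in> vertices n (v, e). card c = 1} = Orbits.orbit v ` {x \<in> {1..2 * n}. v x = x}"
      by (auto simp: vertices_def cycles_on_def sing simp del: One_nat_def)
    also have "\<dots> = (\<lambda>x. {x}) ` {x \<in> {1..2 * n}. v x = x}"
      by (intro image_cong) (auto simp: orbit_eq_singleton_iff)
    finally show ?thesis .
  qed
  then show ?thesis
    by (simp add: num_univalent_def fixed_count_def card_image)
qed

text \<open>The orbit of some \<open>x\<close> under the generated group misses some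
  \<open>y\<close>. It and its complement are both invariant and nonempty, and the smaller of the
  two has at most half of the \<open>2 * n\<close> points.\<close>

lemma disconnected_stable_set:
  assumes v: "v permutes {1..2 * n}" and e: "e permutes {1..2 * n}" and nc: "\<not> connected_map n (v, e)"
  obtains T where "T \<subseteq> {1..2 * n}" "T \<noteq> {}" "card T \<le> n" "v ` T = T" "e ` T = T"
proof -
  let ?G = "sym_group (2 * n)"
  let ?S = "{1..2 * n}"
  interpret group ?G by (rule sym_group_is_group)
  obtain x y where xy: "x \<in> ?S" "y \<in> ?S" "\<And>g. g \<in> generate ?G {v, e} \<Longrightarrow> g x \<noteq> y"
    using nc by (auto simp: connected_map_def)
  define U where "U = {g x | g. g \<in> generate ?G {v, e}}"
  have sub: "generate ?G {v, e} \<subseteq> carrier ?G"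
    using v e by (intro generate_incl) (auto simp: sym_group_carrier)
  have US: "U \<subseteq> ?S"
  proof -
    have "g x \<in> ?S" if "g \<in> generate ?G {v, e}" for g
      using sub that xy(1) permutes_in_image[of g ?S x] by (auto simp only: sym_group_carrier subset_iff)
    then show ?thesis by (auto simp only: U_def)
  qed
  then have finU: "finite U" by (rule finite_subset) simp
  have "x \<in> U"
  proof -
    have "id \<in> generate ?G {v, e}"
      using generate.one[of ?G "{v, e}"] by (simp add: sym_group_one)
    then show ?thesis unfolding U_def by (intro CollectI exI[of _ id]) simp
  qed
  have stab: "w ` U = U" if "w \<in> {v, e}" for w
  proof -
    have "w \<circ> g \<in> generate ?G {v, e}" if "g \<in> generate ?G {v, e}" for g
      using generate.eng[OF generate.incl[OF \<open>w \<in> {v, e}\<close>] that] by (simp add: sym_group_mult)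
    then have sub: "w ` U \<subseteq> U"
      by (auto simp: U_def) (metis comp_apply)
    \<comment> \<open>An injective map of the finite set \<open>U\<close> into itself is onto, which
      upgrades inclusion to equality.\<close>
    have "inj_on w U" using v e that permutes_inj_on by blast
    with sub finU show ?thesis by (simp add: endo_inj_surj)
  qed
  show ?thesis
  proof (cases "card U \<le> n")
    case True
    then show ?thesis using that[of U] US \<open>x \<in> U\<close> stab by blast
  next
    case False
    have "card (?S - U) = 2 * n - card U"
      using US finU by (simp add: card_Diff_subset)
    moreover have "y \<in> ?S - U" using xy by (auto simp: U_def)
    ultimately have "?S - U \<subseteq> ?S" "?S - U \<noteq> {}" "card (?S - U) \<le> n"
      using False by (blast, blast, linarith)
    moreover have "v ` (?S - U) = ?S - U" "e ` (?S - U) = ?S - U"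
      using stab image_Diff_stable[OF v] image_Diff_stable[OF e] by simp_all
    ultimately show ?thesis by (rule that)
  qed
qed

lemma finite_all_pairs: "finite (all_pairs n)"
  by (simp add: all_pairs_def finite_cubic_perms finite_matchings)

lemma card_all_pairs: "card (all_pairs n) = cubic_count (2 * n) * matching_count (2 * n)"
  by (simp add: all_pairs_def card_cartesian_product card_cubic_perms card_matchings)

lemma card_all_pairs_pos: "card (all_pairs n) > 0"
  by (simp add: card_all_pairs cubic_count_pos matching_count_pos)

text \<open>Union bound over the invariant sets of size at most \<open>n\<close>. Those of odd size
  contribute nothing because \<open>e\<close> would restrict to a perfect matching of them, which
  leaves the sizes \<open>2 * j\<close> with \<open>j\<close> at most
  \<open>n div 2\<close>.\<close>

lemma card_disconnected_le:
  "card (all_pairs n - maps13 n)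
     \<le> (\<Sum>j=1..n div 2. (n choose j) * matching_count (2 * n) * (cubic_count (2 * j) * cubic_count (2 * n - 2 * j)))"
proof -
  let ?S = "{1..2 * n}"
  let ?V = "\<lambda>T. {v \<in> cubic_perms ?S. v ` T = T}" and ?E = "\<lambda>T. {e \<in> matchings ?S. e ` T = T}"
  define h where "h s = (cubic_count s * cubic_count (2 * n - s)) * (matching_count s * matching_count (2 * n - s))" for s
  define I where "I s = {T. T \<subseteq> ?S \<and> card T = s}" for s
  have finI: "finite (I s)" for s
    unfolding I_def by (rule finite_subset[of _ "Pow ?S"]) auto
  have "all_pairs n - maps13 n \<subseteq> (\<Union>s\<in>{1..n}. \<Union>T\<in>I s. ?V T \<times> ?E T)"
  proof
    fix m assume m: "m \<in> all_pairs n - maps13 n"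
    then obtain v e where ve: "m = (v, e)" "v \<in> cubic_perms ?S" "e \<in> matchings ?S" "\<not> connected_map n (v, e)"
      by (auto simp: maps13_eq all_pairs_def)
    then obtain T where T: "T \<subseteq> ?S" "T \<noteq> {}" "card T \<le> n" "v ` T = T" "e ` T = T"
      using disconnected_stable_set[of v n e] by (auto simp: cubic_perms_def matchings_def)
    have "finite T" using T(1) finite_subset by blast
    then have "card T \<in> {1..n}" using T by (simp add: Suc_le_eq card_gt_0_iff)
    with T ve show "m \<in> (\<Union>s\<in>{1..n}. \<Union>T\<in>I s. ?V T \<times> ?E T)"
      by (auto simp: I_def)
  qed
  then have "card (all_pairs n - maps13 n) \<le> card (\<Union>s\<in>{1..n}. \<Union>T\<in>I s. ?V T \<times> ?E T)"
    using finI by (intro card_mono) (auto simp: finite_cubic_perms finite_matchings)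
  also have "\<dots> \<le> (\<Sum>s=1..n. card (\<Union>T\<in>I s. ?V T \<times> ?E T))"
    by (rule card_UN_le) simp
  also have "\<dots> \<le> (\<Sum>s=1..n. \<Sum>T\<in>I s. card (?V T \<times> ?E T))"
    using finI by (intro sum_mono card_UN_le)
  also have "\<dots> \<le> (\<Sum>s=1..n. \<Sum>T\<in>I s. h s)"
  proof (intro sum_mono)
    fix s T assume "T \<in> I s"
    then have T: "T \<subseteq> ?S" "card T = s" by (auto simp: I_def)
    show "card (?V T \<times> ?E T) \<le> h s"
      unfolding card_cartesian_product h_def
      using card_stable_cubic_perms_le[OF _ T(1)] card_stable_matchings_le[OF _ T(1)] T(2)
      by (intro mult_mono) simp_all
  qed
  also have "\<dots> = (\<Sum>s=1..n. ((2 * n) choose s) * h s)"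
    using n_subsets[of ?S] by (simp add: I_def)
  also have "\<dots> = (\<Sum>s\<in>(*) 2 ` {1..n div 2}. ((2 * n) choose s) * h s)"
  proof (rule sum.mono_neutral_right)
    show "\<forall>s\<in>{1..n} - (*) 2 ` {1..n div 2}. ((2 * n) choose s) * h s = 0"
    proof
      fix s assume s: "s \<in> {1..n} - (*) 2 ` {1..n div 2}"
      have "odd s"
      proof
        assume "even s"
        then obtain j where "s = 2 * j" by blast
        with s show False by auto
      qed
      then show "((2 * n) choose s) * h s = 0"
        by (simp add: h_def matching_count_odd)
    qed
  qed auto
  also have "\<dots> = (\<Sum>j=1..n div 2. ((2 * n) choose (2 * j)) * h (2 * j))"
    by (subst sum.reindex) (auto simp: inj_on_def)
  also have "\<dots> = (\<Sum>j=1..n div 2. (n choose j) * matching_count (2 * n) * (cubic_count (2 * j) * cubic_count (2 * n - 2 * j)))"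
  proof (rule sum.cong[OF refl])
    fix j assume "j \<in> {1..n div 2}"
    then have "j \<le> n div 2" by simp
    also have "\<dots> \<le> n" by (rule div_le_dividend)
    finally have "j \<le> n" .
    show "((2 * n) choose (2 * j)) * h (2 * j)
      = (n choose j) * matching_count (2 * n) * (cubic_count (2 * j) * cubic_count (2 * n - 2 * j))"
      \<comment> \<open>The split identity replaces the large binomial coefficient by
        \<open>n choose j\<close>, so that the number of matchings becomes a common factor.\<close>
      unfolding matching_count_split[OF \<open>j \<le> n\<close>, symmetric] h_def by (simp add: mult_ac)
  qed
  finally show ?thesis .
qed

lemma disconnected_fraction_le:
  "real (card (all_pairs n - maps13 n)) / real (card (all_pairs n))
     \<le> (\<Sum>j=1..n div 2. real (n choose j) * (real (cubic_count (2 * j)) * real (cubic_count (2 * n - 2 * j)))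
            / real (cubic_count (2 * n)))"
proof -
  have "real (card (all_pairs n - maps13 n)) / real (card (all_pairs n))
     \<le> real (\<Sum>j=1..n div 2. (n choose j) * matching_count (2 * n) * (cubic_count (2 * j) * cubic_count (2 * n - 2 * j)))
        / real (card (all_pairs n))"
    using card_disconnected_le[of n] by (intro divide_right_mono) (simp_all only: of_nat_le_iff of_nat_0_le_iff)
  also have "\<dots> = (\<Sum>j=1..n div 2. real (n choose j) * (real (cubic_count (2 * j)) * real (cubic_count (2 * n - 2 * j)))
            / real (cubic_count (2 * n)))"
    unfolding of_nat_sum sum_divide_distrib card_all_pairs
    using matching_count_pos[of n] cubic_count_pos[of "2 * n"]
    by (intro sum.cong refl) (simp add: field_simps)
  finally show ?thesis .
qed

section \<open>The Stein equation\<close>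

text \<open>Uniform means are finite sums, equal to 0 over the empty set; real moments and complex
  characteristic functions share this one notion.\<close>

definition avg :: "'a set \<Rightarrow> ('a \<Rightarrow> 'b) \<Rightarrow> 'b::real_vector" where
  "avg A f = (\<Sum>a\<in>A. f a) /\<^sub>R real (card A)"

lemma avg_add: "avg A (\<lambda>a. f a + g a) = avg A f + avg A g"
  by (simp add: avg_def sum.distrib scaleR_add_right)

lemma avg_diff: "avg A (\<lambda>a. f a - g a) = avg A f - avg A g"
  by (simp add: avg_def sum_subtractf scaleR_diff_right)

lemma avg_mult_left:
  fixes c :: "'b::real_algebra"
  shows "avg A (\<lambda>a. c * f a) = c * avg A f"
  by (simp add: avg_def sum_distrib_left)

lemma avg_const: "finite A \<Longrightarrow> A \<noteq> {} \<Longrightarrow> avg A (\<lambda>_. c) = c"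
  by (simp add: avg_def scaleR_conv_of_real sum_constant_scaleR)

lemma avg_mono:
  fixes f :: "'a \<Rightarrow> real"
  shows "(\<And>a. a \<in> A \<Longrightarrow> f a \<le> g a) \<Longrightarrow> avg A f \<le> avg A g"
  by (auto simp: avg_def intro!: mult_left_mono sum_mono)

lemma norm_avg_le: "norm (avg A f) \<le> avg A (\<lambda>a. norm (f a))"
  by (simp add: avg_def mult_left_mono norm_sum)

lemma avg_of_real: "avg A (\<lambda>a. of_real (f a)) = (of_real (avg A f) :: 'b::real_algebra_1)"
  by (simp add: avg_def scaleR_conv_of_real)

lemma avg_cong: "(\<And>a. a \<in> A \<Longrightarrow> f a = g a) \<Longrightarrow> avg A f = avg A g"
  by (simp add: avg_def)

text \<open>
  The exchange identity is a Stein equation: with \<open>D = X - 1 - \<kappa>\<close>, \<open>\<kappa> = N\<^sup>1\<^sup>/\<^sup>3\<close>, it says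
  \<open>E[D Q g(D)] = E[(N - X) (g(D + 3) - g(D))] - E[g(D)]\<close>, where \<open>Q \<approx> 3 \<kappa>\<^sup>2\<close> and \<open>N - X \<approx> \<kappa>\<^sup>3\<close>.
  So \<open>D / sqrt \<kappa>\<close> satisfies the Stein equation of the normal law up to \<open>O(\<kappa> powr (-1/2))\<close>.
\<close>

locale cubic_exchange =
  fixes A :: "'a set" and X :: "'a \<Rightarrow> nat" and N :: nat
  assumes fin: "finite A" and ne: "A \<noteq> {}"
    and X_le: "\<And>a. a \<in> A \<Longrightarrow> X a \<le> N" and N_pos: "N \<ge> 1"
    and exch: "\<And>g :: nat \<Rightarrow> complex.
      (\<Sum>a\<in>A. of_nat (X a * (X a - 1) * (X a - 2)) * g (X a)) = (\<Sum>a\<in>A. of_nat (N - X a) * g (X a + 3))"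
begin

definition \<kappa> :: real where "\<kappa> = root 3 (real N)"

text \<open>The centre is \<open>1 + \<kappa>\<close> because \<open>x (x - 1) (x - 2)\<close>
  equals \<open>(x - 1) ^ 3 - (x - 1)\<close>: the leading cube balances \<open>N\<close> exactly at
  \<open>x = 1 + \<kappa>\<close>.\<close>

definition D :: "'a \<Rightarrow> real" where "D a = real (X a) - 1 - \<kappa>"

text \<open>The cofactor of \<open>D\<close> in the difference of cubes
  \<open>(X - 1) ^ 3 - \<kappa> ^ 3\<close>, expanded in powers of \<open>D\<close>.\<close>

definition Q :: "'a \<Rightarrow> real" where "Q a = 3 * \<kappa>\<^sup>2 + 3 * \<kappa> * D a + (D a)\<^sup>2"

lemma kappa_cube: "\<kappa> ^ 3 = real N"
  unfolding \<kappa>_def by (rule real_root_pow_pos2) auto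

lemma kappa_ge_1: "\<kappa> \<ge> 1"
  unfolding \<kappa>_def using N_pos by simp

lemma D_mult_Q: "D a * Q a = (real (X a) - 1) ^ 3 - real N"
  unfolding kappa_cube[symmetric] Q_def D_def by (simp add: algebra_simps power2_eq_square power3_eq_cube)

text \<open>Truncated subtraction on \<open>nat\<close> does no harm, as the polynomial on the right
  also vanishes at 0 and 1.\<close>

lemma falling_factorial_3: "real (x * (x - 1) * (x - 2)) = (real x - 1) ^ 3 - (real x - 1)"
proof -
  consider "x = 0" | "x = 1" | y where "x = y + 2"
    by (metis One_nat_def add_2_eq_Suc' not0_implies_Suc)
  then show ?thesis
  proof cases
    case 3
    then show ?thesis by (simp add: algebra_simps power3_eq_cube)
  qed simp_all
qed

text \<open>\<open>D * Q\<close> is the falling factorial of \<open>X\<close> minus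
  \<open>N - X\<close> minus 1. The exchange identity turns the falling factorial into a shift of
  \<open>g\<close> by 3, and the second term completes the difference
  \<open>g (D + 3) - g D\<close>.\<close>

lemma stein_identity:
  fixes g :: "real \<Rightarrow> complex"
  shows "avg A (\<lambda>a. of_real (D a * Q a) * g (D a))
       = avg A (\<lambda>a. of_real (real N - real (X a)) * (g (D a + 3) - g (D a))) - avg A (\<lambda>a. g (D a))"
proof -
  define h where "h x = g (real x - 1 - \<kappa>)" for x
  have hX: "h (X a) = g (D a)" "h (X a + 3) = g (D a + 3)" for a
    by (simp_all add: h_def D_def algebra_simps)
  have "(\<Sum>a\<in>A. of_real (D a * Q a) * g (D a)) =
      (\<Sum>a\<in>A. of_nat (X a * (X a - 1) * (X a - 2)) * h (X a)) -
      (\<Sum>a\<in>A. of_real (real N - real (X a)) * g (D a)) - (\<Sum>a\<in>A. g (D a))"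
    unfolding sum_subtractf[symmetric]
  proof (rule sum.cong[OF refl])
    fix a
    have "(of_nat (X a * (X a - 1) * (X a - 2)) :: complex) = of_real ((real (X a) - 1) ^ 3 - (real (X a) - 1))"
      unfolding falling_factorial_3[symmetric] by simp
    then show "of_real (D a * Q a) * g (D a) = of_nat (X a * (X a - 1) * (X a - 2)) * h (X a) -
        of_real (real N - real (X a)) * g (D a) - g (D a)"
      by (simp only: D_mult_Q hX) (simp add: algebra_simps)
  qed
  also have "(\<Sum>a\<in>A. of_nat (X a * (X a - 1) * (X a - 2)) * h (X a)) =
      (\<Sum>a\<in>A. of_real (real N - real (X a)) * g (D a + 3))"
    unfolding exch using X_le by (intro sum.cong refl) (simp add: hX of_nat_diff)
  finally show ?thesis
    by (simp add: avg_def sum_subtractf right_diff_distrib flip: scaleR_diff_right)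
qed

lemma stein_identity_real:
  fixes g :: "real \<Rightarrow> real"
  shows "avg A (\<lambda>a. D a * Q a * g (D a))
       = avg A (\<lambda>a. (real N - real (X a)) * (g (D a + 3) - g (D a))) - avg A (\<lambda>a. g (D a))"
proof -
  have "complex_of_real (avg A (\<lambda>a. D a * Q a * g (D a))) =
      complex_of_real (avg A (\<lambda>a. (real N - real (X a)) * (g (D a + 3) - g (D a))) - avg A (\<lambda>a. g (D a)))"
    using stein_identity[of "\<lambda>x. complex_of_real (g x)"]
    by (simp add: avg_of_real flip: of_real_mult of_real_diff)
  then show ?thesis by (simp only: of_real_eq_iff)
qed

section \<open>Moments of the deviation up to order four\<close>

lemma Q_ge: "Q a \<ge> 3/4 * \<kappa>\<^sup>2"
proof -
  have "Q a = (D a + 3/2 * \<kappa>)\<^sup>2 + 3/4 * \<kappa>\<^sup>2"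
    by (simp add: Q_def power2_eq_square algebra_simps)
  then show ?thesis by simp
qed

lemma D_ge: "- D a \<le> 2 * \<kappa>"
  using kappa_ge_1 by (simp add: D_def)

text \<open>The test function \<open>g x = x\<close>, with \<open>Q\<close> bounded below by
  \<open>3/4 * \<kappa>\<^sup>2\<close>. This crude bound feeds the fourth moment and is sharpened
  afterwards; 7 exceeds 5 divided by 3/4.\<close>

lemma avg_D_squared_le: "avg A (\<lambda>a. (D a)\<^sup>2) \<le> 7 * \<kappa>"
proof -
  have k: "\<kappa> \<ge> 1" by (rule kappa_ge_1)
  have "3/4 * \<kappa>\<^sup>2 * avg A (\<lambda>a. (D a)\<^sup>2) = avg A (\<lambda>a. 3/4 * \<kappa>\<^sup>2 * (D a)\<^sup>2)"
    by (simp only: avg_mult_left)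
  also have "\<dots> \<le> avg A (\<lambda>a. D a * Q a * D a)"
  proof (rule avg_mono)
    fix a
    have "3/4 * \<kappa>\<^sup>2 * (D a)\<^sup>2 \<le> Q a * (D a)\<^sup>2"
      using Q_ge by (rule mult_right_mono) simp
    then show "3/4 * \<kappa>\<^sup>2 * (D a)\<^sup>2 \<le> D a * Q a * D a"
      by (simp add: power2_eq_square algebra_simps)
  qed
  also have "\<dots> = avg A (\<lambda>a. (real N - real (X a)) * 3 - D a)"
    using stein_identity_real[of "\<lambda>x. x"] by (simp add: avg_diff)
  also have "\<dots> \<le> avg A (\<lambda>_. 3 * \<kappa> ^ 3 + 2 * \<kappa>)"
  proof (rule avg_mono)
    fix a show "(real N - real (X a)) * 3 - D a \<le> 3 * \<kappa> ^ 3 + 2 * \<kappa>"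
      unfolding kappa_cube using D_ge[of a] by simp
  qed
  also have "\<dots> = 3 * \<kappa> ^ 3 + 2 * \<kappa>" by (rule avg_const[OF fin ne])
  also have "\<dots> \<le> 5 * \<kappa> ^ 3"
    using k power_increasing[of 1 3 \<kappa>] by simp
  also have "\<dots> \<le> 3/4 * \<kappa>\<^sup>2 * (7 * \<kappa>)"
    using k by (simp add: power2_eq_square power3_eq_cube)
  finally show ?thesis using k by (subst (asm) mult_le_cancel_left_pos) auto
qed

text \<open>The test function \<open>g x = x ^ 3\<close>: its difference is quadratic in
  \<open>D\<close>, so the second moment bound controls the right-hand side.\<close>

lemma avg_D_fourth_le: "avg A (\<lambda>a. (D a) ^ 4) \<le> 280 * \<kappa>\<^sup>2"
proof -
  have k: "\<kappa> \<ge> 1" by (rule kappa_ge_1)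
  have "3/4 * \<kappa>\<^sup>2 * avg A (\<lambda>a. (D a) ^ 4) = avg A (\<lambda>a. 3/4 * \<kappa>\<^sup>2 * (D a) ^ 4)"
    by (simp only: avg_mult_left)
  also have "\<dots> \<le> avg A (\<lambda>a. D a * Q a * (D a) ^ 3)"
  proof (rule avg_mono)
    fix a
    have "3/4 * \<kappa>\<^sup>2 * (D a) ^ 4 \<le> Q a * (D a) ^ 4"
      using Q_ge by (rule mult_right_mono) simp
    then show "3/4 * \<kappa>\<^sup>2 * (D a) ^ 4 \<le> D a * Q a * (D a) ^ 3"
      by (simp add: eval_nat_numeral algebra_simps)
  qed
  also have "\<dots> = avg A (\<lambda>a. (real N - real (X a)) * ((D a + 3) ^ 3 - (D a) ^ 3) - (D a) ^ 3)"
    using stein_identity_real[of "\<lambda>x. x ^ 3"] by (simp add: avg_diff)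
  also have "\<dots> \<le> avg A (\<lambda>a. 23 * \<kappa> ^ 3 * (D a)\<^sup>2 + 49 * \<kappa> ^ 3)"
  proof (rule avg_mono)
    fix a assume a: "a \<in> A"
    have sq: "(D a + 3) ^ 3 - (D a) ^ 3 = 9 * (D a)\<^sup>2 + 27 * D a + 27"
      by (simp add: eval_nat_numeral algebra_simps)
    have "0 \<le> (D a + 1)\<^sup>2" "0 \<le> (D a - 1)\<^sup>2" by simp_all
    then have up: "27 * D a \<le> 27/2 * (D a)\<^sup>2 + 27/2" and lo: "0 \<le> 9 * (D a)\<^sup>2 + 27 * D a + 27"
      using zero_le_power2[of "D a + 3/2"] zero_le_power2[of "D a"]
      by (simp_all add: power2_eq_square algebra_simps)
    \<comment> \<open>The difference is nonnegative by \<open>lo\<close>, so \<open>N - X\<close>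
      may be enlarged to \<open>N\<close>. The bound \<open>up\<close> then gives coefficients 45/2
      and 81/2, rounded to 23 and 41; the term \<open>- D ^ 3\<close> adds 8 to the latter.\<close>
    have "(real N - real (X a)) * ((D a + 3) ^ 3 - (D a) ^ 3) \<le> real N * ((D a + 3) ^ 3 - (D a) ^ 3)"
      unfolding sq by (rule mult_right_mono) (use lo in auto)
    also have "\<dots> \<le> real N * (23 * (D a)\<^sup>2 + 41)"
      unfolding sq by (rule mult_left_mono) (use up zero_le_power2[of "D a"] in \<open>linarith | simp\<close>)+
    finally have 1: "(real N - real (X a)) * ((D a + 3) ^ 3 - (D a) ^ 3) \<le> \<kappa> ^ 3 * (23 * (D a)\<^sup>2 + 41)"
      by (simp only: kappa_cube)
    have "(- D a) ^ 3 \<le> (2 * \<kappa>) ^ 3"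
      using power_mono_odd[of 3 "- D a" "2 * \<kappa>"] D_ge[of a] by simp
    then have "- ((D a) ^ 3) \<le> 8 * \<kappa> ^ 3"
      by (simp add: power_mult_distrib power_minus_odd)
    with 1 show "(real N - real (X a)) * ((D a + 3) ^ 3 - (D a) ^ 3) - (D a) ^ 3
        \<le> 23 * \<kappa> ^ 3 * (D a)\<^sup>2 + 49 * \<kappa> ^ 3"
      by (simp add: algebra_simps)
  qed
  also have "\<dots> = 23 * \<kappa> ^ 3 * avg A (\<lambda>a. (D a)\<^sup>2) + 49 * \<kappa> ^ 3"
    by (simp only: avg_add avg_mult_left avg_const[OF fin ne])
  also have "\<dots> \<le> 23 * \<kappa> ^ 3 * (7 * \<kappa>) + 49 * \<kappa> ^ 4"
    using k power_increasing[of 3 4 \<kappa>]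
    by (intro add_mono mult_left_mono avg_D_squared_le) auto
  also have "\<dots> = 3/4 * \<kappa>\<^sup>2 * (280 * \<kappa>\<^sup>2)"
    by (simp add: eval_nat_numeral)
  finally show ?thesis using k by (subst (asm) mult_le_cancel_left_pos) auto
qed

text \<open>The scale of the standard deviation; writing all bounds in powers of \<open>s\<close>
  avoids fractional exponents.\<close>

definition s :: real where "s = sqrt \<kappa>"

lemma s_squared: "s\<^sup>2 = \<kappa>"
  unfolding s_def using kappa_ge_1 by simp

lemma s_ge_1: "s \<ge> 1"
  unfolding s_def using kappa_ge_1 by simp

text \<open>Interpolation between the second and fourth moments by the inequality of arithmetic and
  geometric means, weighted by \<open>s\<close> so that both contribute order
  \<open>s ^ 3\<close>.\<close>

lemma avg_abs_D_cubed_le: "avg A (\<lambda>a. \<bar>D a\<bar> ^ 3) \<le> 144 * s ^ 3"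
proof -
  have s: "s \<ge> 1" by (rule s_ge_1)
  have k: "\<kappa> = s\<^sup>2" by (simp add: s_squared)
  have "avg A (\<lambda>a. \<bar>D a\<bar> ^ 3) \<le> avg A (\<lambda>a. (s / 2) * (D a)\<^sup>2 + (1 / (2 * s)) * (D a) ^ 4)"
  proof (rule avg_mono)
    fix a
    have "0 \<le> (D a)\<^sup>2 * (s - \<bar>D a\<bar>)\<^sup>2" by simp
    also have "\<dots> = s\<^sup>2 * (D a)\<^sup>2 + (D a) ^ 4 - 2 * s * \<bar>D a\<bar> ^ 3"
      by (simp add: eval_nat_numeral algebra_simps)
    finally show "\<bar>D a\<bar> ^ 3 \<le> (s / 2) * (D a)\<^sup>2 + (1 / (2 * s)) * (D a) ^ 4"
      using s by (simp add: field_simps power2_eq_square)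
  qed
  also have "\<dots> = (s / 2) * avg A (\<lambda>a. (D a)\<^sup>2) + (1 / (2 * s)) * avg A (\<lambda>a. (D a) ^ 4)"
    by (simp only: avg_add avg_mult_left)
  also have "\<dots> \<le> (s / 2) * (7 * \<kappa>) + (1 / (2 * s)) * (280 * \<kappa>\<^sup>2)"
    using s by (intro add_mono mult_left_mono avg_D_squared_le avg_D_fourth_le) auto
  also have "\<dots> \<le> 144 * s ^ 3"
    unfolding k using s by (simp add: eval_nat_numeral field_simps)
  finally show ?thesis .
qed

lemma abs_avg_D_cubed_le: "\<bar>avg A (\<lambda>a. (D a) ^ 3)\<bar> \<le> 144 * s ^ 3"
  using norm_avg_le[of A "\<lambda>a. (D a) ^ 3"] avg_abs_D_cubed_le by (simp add: power_abs)

lemma avg_D_even_nonneg: "avg A (\<lambda>a. (D a)\<^sup>2) \<ge> 0" "avg A (\<lambda>a. (D a) ^ 4) \<ge> 0"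
  by (simp_all add: avg_def sum_nonneg)

lemma s_power_mono: "i \<le> j \<Longrightarrow> s ^ i \<le> s ^ j"
  using s_ge_1 by (rule power_increasing[rotated])

text \<open>The constant test function gives mean \<open>- 1\<close> for \<open>D * Q\<close>. In
  its expansion the first moment carries the factor \<open>3 * \<kappa>\<^sup>2\<close>, while the
  remaining terms are of order at most \<open>\<kappa>\<^sup>2\<close>, so the bias is
  bounded.\<close>

lemma abs_avg_D_le: "\<bar>avg A D\<bar> \<le> 56"
proof -
  have s: "s \<ge> 1" by (rule s_ge_1)
  have k: "\<kappa> = s\<^sup>2" by (simp add: s_squared)
  have "avg A (\<lambda>a. D a * Q a) = - 1"
    using stein_identity_real[of "\<lambda>_. 1"] by (simp add: avg_const[OF fin ne])
  moreover have "avg A (\<lambda>a. D a * Q a) =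
      avg A (\<lambda>a. 3 * \<kappa>\<^sup>2 * D a + 3 * \<kappa> * (D a)\<^sup>2 + (D a) ^ 3)"
    by (rule avg_cong) (simp add: Q_def eval_nat_numeral algebra_simps)
  ultimately have "3 * s ^ 4 * avg A D = - 1 - 3 * s\<^sup>2 * avg A (\<lambda>a. (D a)\<^sup>2) - avg A (\<lambda>a. (D a) ^ 3)"
    by (simp add: avg_add avg_mult_left k)
  moreover have "3 * s\<^sup>2 * avg A (\<lambda>a. (D a)\<^sup>2) \<le> 3 * s\<^sup>2 * (7 * s\<^sup>2)"
    by (intro mult_left_mono avg_D_squared_le[unfolded k]) auto
  moreover have "3 * s\<^sup>2 * (7 * s\<^sup>2) = 21 * s ^ 4" by (simp add: eval_nat_numeral)
  moreover have "3 * s\<^sup>2 * avg A (\<lambda>a. (D a)\<^sup>2) \<ge> 0"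
    by (intro mult_nonneg_nonneg avg_D_even_nonneg) auto
  ultimately have "\<bar>3 * s ^ 4 * avg A D\<bar> \<le> 1 + 21 * s ^ 4 + 144 * s ^ 3"
    using abs_avg_D_cubed_le by linarith
  also have "\<dots> \<le> 3 * s ^ 4 * 56"
    using s_power_mono[of 3 4] s_power_mono[of 0 4] by simp
  finally have "3 * s ^ 4 * \<bar>avg A D\<bar> \<le> 3 * s ^ 4 * 56"
    using s by (simp add: abs_mult)
  then show ?thesis using s by (subst (asm) mult_le_cancel_left_pos) auto
qed

lemma avg_X: "avg A (\<lambda>a. real (X a)) = \<kappa> + 1 + avg A D"
proof -
  have "avg A (\<lambda>a. real (X a)) = avg A (\<lambda>a. (\<kappa> + 1) + D a)"
    by (rule avg_cong) (simp add: D_def)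
  then show ?thesis by (simp only: avg_add avg_const[OF fin ne])
qed

text \<open>The test function \<open>g x = x\<close> again, now with every term kept. The main terms
  are \<open>3 * s ^ 4\<close> times the second moment and \<open>3 * s ^ 6\<close>; the largest
  error is the third moment term, of order \<open>s ^ 5\<close>.\<close>

lemma abs_avg_D_squared_diff_le: "\<bar>avg A (\<lambda>a. (D a)\<^sup>2) - \<kappa>\<bar> \<le> 320 * s"
proof -
  have s: "s \<ge> 1" by (rule s_ge_1)
  have k: "\<kappa> = s\<^sup>2" by (simp add: s_squared)
  have N: "real N = s ^ 6" by (simp add: k flip: kappa_cube power_mult)
  have "avg A (\<lambda>a. D a * Q a * D a) = avg A (\<lambda>a. 3 * real N - 3 * real (X a)) - avg A D"
    using stein_identity_real[of "\<lambda>x. x"] by (simp add: algebra_simps)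
  also have "\<dots> = 3 * s ^ 6 - 3 * (s\<^sup>2 + 1 + avg A D) - avg A D"
    by (simp only: avg_diff avg_mult_left avg_const[OF fin ne] avg_X N k)
  finally have 1: "avg A (\<lambda>a. D a * Q a * D a) = 3 * s ^ 6 - 3 * (s\<^sup>2 + 1 + avg A D) - avg A D" .
  have "avg A (\<lambda>a. D a * Q a * D a) =
      avg A (\<lambda>a. 3 * \<kappa>\<^sup>2 * (D a)\<^sup>2 + 3 * \<kappa> * (D a) ^ 3 + (D a) ^ 4)"
    by (rule avg_cong) (simp add: Q_def eval_nat_numeral algebra_simps)
  also have "\<dots> = 3 * s ^ 4 * avg A (\<lambda>a. (D a)\<^sup>2) + 3 * s\<^sup>2 * avg A (\<lambda>a. (D a) ^ 3) + avg A (\<lambda>a. (D a) ^ 4)"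
    by (simp add: avg_add avg_mult_left k)
  finally have 2: "3 * s ^ 4 * avg A (\<lambda>a. (D a)\<^sup>2) - 3 * s ^ 6 =
      - 3 * s\<^sup>2 - 3 - 4 * avg A D - 3 * s\<^sup>2 * avg A (\<lambda>a. (D a) ^ 3) - avg A (\<lambda>a. (D a) ^ 4)"
    using 1 by (simp add: algebra_simps)
  have "\<bar>3 * s\<^sup>2 * avg A (\<lambda>a. (D a) ^ 3)\<bar> \<le> 3 * s\<^sup>2 * (144 * s ^ 3)"
    unfolding abs_mult[of "3 * s\<^sup>2"] using abs_avg_D_cubed_le by (intro mult_mono) auto
  also have "\<dots> = 432 * s ^ 5" by (simp add: eval_nat_numeral)
  finally have "\<bar>3 * s ^ 4 * avg A (\<lambda>a. (D a)\<^sup>2) - 3 * s ^ 6\<bar> \<le>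
      3 * s\<^sup>2 + 3 + 4 * 56 + 432 * s ^ 5 + 280 * s ^ 4"
    unfolding 2 using avg_D_even_nonneg(2) avg_D_fourth_le[unfolded k] abs_avg_D_le
    by (simp flip: power_mult) (smt (verit) zero_le_power2)
  also have "\<dots> \<le> 3 * s ^ 4 * (320 * s)"
    using s_power_mono[of 2 5] s_power_mono[of 0 5] s_power_mono[of 4 5]
    by (simp add: eval_nat_numeral)
  also have "3 * s ^ 4 * avg A (\<lambda>a. (D a)\<^sup>2) - 3 * s ^ 6 = 3 * s ^ 4 * (avg A (\<lambda>a. (D a)\<^sup>2) - \<kappa>)"
    by (simp add: k eval_nat_numeral algebra_simps)
  finally have "3 * s ^ 4 * \<bar>avg A (\<lambda>a. (D a)\<^sup>2) - \<kappa>\<bar> \<le> 3 * s ^ 4 * (320 * s)"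
    using s by (simp add: abs_mult)
  then show ?thesis using s by (subst (asm) mult_le_cancel_left_pos) auto
qed

section \<open>The characteristic function and its approximate differential equation\<close>

definition \<phi> :: "real \<Rightarrow> complex" where
  "\<phi> t = avg A (\<lambda>a. iexp (t * (D a / s)))"

text \<open>The mean on the left, multiplied by the imaginary unit, is the derivative of
  \<open>\<phi>\<close>, so this is \<open>\<phi>'(t) = - t * \<phi> t\<close> with an error of
  order \<open>1 / s\<close>. It comes from exponential test functions, whose difference is a
  multiple \<open>z\<close> of themselves.\<close>

lemma stein_char_bound:
  "norm (avg A (\<lambda>a. of_real (D a / s) * iexp (t * (D a / s))) - \<i> * of_real t * \<phi> t)
     \<le> 100 * (1 + t\<^sup>2) / s"
proof -
  have s: "s \<ge> 1" by (rule s_ge_1)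
  have k: "\<kappa> = s\<^sup>2" by (simp add: s_squared)
  have N: "real N = s ^ 6" by (simp add: k flip: kappa_cube power_mult)
  define c where "c = t / s"
  define g where "g x = iexp (c * x)" for x :: real
  define z where "z = iexp (3 * c) - 1"
  have norm_g: "norm (g x) = 1" for x by (simp add: g_def)
  have gshift: "g (x + 3) - g x = z * g x" for x
    by (simp add: g_def z_def distrib_left exp_add algebra_simps)
  have phi: "\<phi> t = avg A (\<lambda>a. g (D a))" by (simp add: \<phi>_def g_def c_def)
  define G where "G k = avg A (\<lambda>a. of_real ((D a) ^ k) * g (D a))" for k
  define H where "H = avg A (\<lambda>a. of_real (real (X a)) * g (D a))"
  have "avg A (\<lambda>a. of_real (D a * Q a) * g (D a)) = 3 * \<kappa>\<^sup>2 * G 1 + 3 * \<kappa> * G 2 + G 3"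
  proof -
    have "avg A (\<lambda>a. of_real (D a * Q a) * g (D a)) =
      avg A (\<lambda>a. complex_of_real (3 * \<kappa>\<^sup>2) * (of_real ((D a) ^ 1) * g (D a)) +
         complex_of_real (3 * \<kappa>) * (of_real ((D a) ^ 2) * g (D a)) + of_real ((D a) ^ 3) * g (D a))"
      by (rule avg_cong) (simp add: Q_def eval_nat_numeral algebra_simps)
    then show ?thesis unfolding avg_add avg_mult_left G_def by simp
  qed
  moreover have "avg A (\<lambda>a. of_real (real N - real (X a)) * (g (D a + 3) - g (D a))) =
      z * (of_real (real N) * \<phi> t - H)"
  proof -
    have "avg A (\<lambda>a. of_real (real N - real (X a)) * (g (D a + 3) - g (D a))) =
        avg A (\<lambda>a. z * (of_real (real N) * g (D a) - of_real (real (X a)) * g (D a)))"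
      unfolding gshift by (rule avg_cong) (simp add: algebra_simps)
    then show ?thesis unfolding avg_mult_left avg_diff H_def phi .
  qed
  ultimately have main: "3 * \<kappa>\<^sup>2 * G 1 + 3 * \<kappa> * G 2 + G 3 = z * (of_real (real N) * \<phi> t - H) - \<phi> t"
    using stein_identity[of g] by (simp only: phi)
  have norm_phi: "norm (\<phi> t) \<le> 1"
    using norm_avg_le[of A "\<lambda>a. g (D a)"] by (simp add: phi norm_g avg_const[OF fin ne])
  have norm_G2: "norm (G 2) \<le> 7 * s\<^sup>2"
    using norm_avg_le[of A "\<lambda>a. of_real ((D a) ^ 2) * g (D a)"] avg_D_squared_le
    by (simp add: G_def norm_mult norm_g norm_power k)
  have norm_G3: "norm (G 3) \<le> 144 * s ^ 3"
    using norm_avg_le[of A "\<lambda>a. of_real ((D a) ^ 3) * g (D a)"] avg_abs_D_cubed_le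
    by (simp add: G_def norm_mult norm_g norm_power)
  have norm_H: "norm H \<le> 58 * s\<^sup>2"
  proof -
    have "norm H \<le> avg A (\<lambda>a. real (X a))"
      using norm_avg_le[of A "\<lambda>a. of_real (real (X a)) * g (D a)"] by (simp add: H_def norm_mult norm_g)
    also have "\<dots> \<le> 58 * s\<^sup>2"
      unfolding avg_X using abs_avg_D_le s_power_mono[of 0 2] by (simp add: k)
    finally show ?thesis .
  qed
  \<comment> \<open>Taylor bounds of order 0 and 1: the first suffices against \<open>H\<close>,
    which is of order \<open>s\<^sup>2\<close>, while the factor \<open>N\<close> requires the
    second.\<close>
  have z1: "norm z \<le> 3 * \<bar>c\<bar>"
    using iexp_approx1[of "3 * c" 0] by (simp add: z_def abs_mult)
  have z2: "norm (z - 3 * \<i> * of_real c) \<le> 9/2 * c\<^sup>2"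
    using iexp_approx1[of "3 * c" 1]
    by (simp add: z_def algebra_simps abs_mult power2_eq_square flip: abs_mult)
  have "3 * \<kappa>\<^sup>2 * G 1 - 3 * \<i> * of_real c * of_real (real N) * \<phi> t =
      (z - 3 * \<i> * of_real c) * of_real (real N) * \<phi> t - z * H - \<phi> t - 3 * \<kappa> * G 2 - G 3"
    using main by (simp add: algebra_simps)
  also have "norm \<dots> \<le> norm ((z - 3 * \<i> * of_real c) * of_real (real N) * \<phi> t) + norm (z * H) +
      norm (\<phi> t) + norm (3 * \<kappa> * G 2) + norm (G 3)"
    by (intro norm_triangle_le_diff add_mono order_refl)
  also have "\<dots> \<le> 9/2 * c\<^sup>2 * real N * 1 + 3 * \<bar>c\<bar> * (58 * s\<^sup>2) + 1 + 3 * s\<^sup>2 * (7 * s\<^sup>2) + 144 * s ^ 3"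
  proof (intro add_mono norm_phi norm_G3)
    show "norm ((z - 3 * \<i> * of_real c) * of_real (real N) * \<phi> t) \<le> 9/2 * c\<^sup>2 * real N * 1"
      unfolding norm_mult using z2 norm_phi by (intro mult_mono) auto
    show "norm (z * H) \<le> 3 * \<bar>c\<bar> * (58 * s\<^sup>2)"
      unfolding norm_mult using z1 norm_H by (intro mult_mono) auto
    show "norm (3 * \<kappa> * G 2) \<le> 3 * s\<^sup>2 * (7 * s\<^sup>2)"
      unfolding norm_mult using norm_G2 by (intro mult_mono) (auto simp: k norm_power)
  qed
  also have "\<dots> = 9/2 * t\<^sup>2 * s ^ 4 + 174 * \<bar>t\<bar> * s + 1 + 21 * s ^ 4 + 144 * s ^ 3"
    using s by (simp add: c_def N field_simps eval_nat_numeral)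
  also have "\<dots> \<le> s ^ 4 * (300 * (1 + t\<^sup>2))"
  proof -
    \<comment> \<open>The estimate for \<open>2 * \<bar>t\<bar>\<close> removes the linear term; the
      coefficients then total 253 for \<open>s ^ 4\<close> and 183/2 for \<open>T\<close>, both
      below 300.\<close>
    have "0 \<le> (\<bar>t\<bar> - 1)\<^sup>2" by simp
    then have t: "2 * \<bar>t\<bar> \<le> 1 + t\<^sup>2" by (simp add: power2_eq_square algebra_simps)
    define T where "T = t\<^sup>2 * s ^ 4"
    have "2 * \<bar>t\<bar> * s \<le> (1 + t\<^sup>2) * s ^ 4"
      using t s_power_mono[of 1 4] s by (intro mult_mono) auto
    also have "\<dots> = s ^ 4 + T" by (simp add: T_def algebra_simps)
    finally have "2 * \<bar>t\<bar> * s \<le> s ^ 4 + T" .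
    moreover have "0 \<le> T" by (simp add: T_def)
    moreover have "s ^ 4 * (300 * (1 + t\<^sup>2)) = 300 * s ^ 4 + 300 * T"
      "9/2 * t\<^sup>2 * s ^ 4 = 9/2 * T" "174 * \<bar>t\<bar> * s = 87 * (2 * \<bar>t\<bar> * s)"
      by (simp_all add: T_def algebra_simps)
    moreover have "s ^ 3 \<le> s ^ 4" "1 \<le> s ^ 4"
      using s_power_mono[of 3 4] s_power_mono[of 0 4] by simp_all
    ultimately show ?thesis by linarith
  qed
  finally have bound: "norm (3 * \<kappa>\<^sup>2 * G 1 - 3 * \<i> * of_real c * of_real (real N) * \<phi> t) \<le> s ^ 4 * (300 * (1 + t\<^sup>2))" .
  have "avg A (\<lambda>a. of_real (D a / s) * iexp (t * (D a / s))) = of_real (1 / s) * G 1"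
    unfolding G_def avg_mult_left[symmetric]
    by (rule avg_cong) (simp add: g_def c_def)
  \<comment> \<open>The factor \<open>3 * s ^ 5\<close> is \<open>3 * \<kappa>\<^sup>2 * s\<close>,
    and \<open>c * N\<close> is \<open>t * s ^ 5\<close>; dividing by it leaves an error of order
    \<open>1 / s\<close>.\<close>
  then have "of_real (3 * s ^ 5) * (avg A (\<lambda>a. of_real (D a / s) * iexp (t * (D a / s))) - \<i> * of_real t * \<phi> t)
     = 3 * \<kappa>\<^sup>2 * G 1 - 3 * \<i> * of_real c * of_real (real N) * \<phi> t"
    using s unfolding N k c_def by (simp add: field_simps eval_nat_numeral)
  with bound have "norm (complex_of_real (3 * s ^ 5) *
      (avg A (\<lambda>a. of_real (D a / s) * iexp (t * (D a / s))) - \<i> * of_real t * \<phi> t)) \<le> s ^ 4 * (300 * (1 + t\<^sup>2))"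
    by simp
  also have "s ^ 4 * (300 * (1 + t\<^sup>2)) = 3 * s ^ 5 * (100 * (1 + t\<^sup>2) / s)"
    using s by (simp add: field_simps eval_nat_numeral)
  finally have "\<bar>3 * s ^ 5\<bar> * norm (avg A (\<lambda>a. of_real (D a / s) * iexp (t * (D a / s))) - \<i> * of_real t * \<phi> t)
      \<le> 3 * s ^ 5 * (100 * (1 + t\<^sup>2) / s)"
    unfolding norm_mult norm_of_real .
  moreover have "\<bar>3 * s ^ 5\<bar> = 3 * s ^ 5" "3 * s ^ 5 > 0"
    using s by simp_all
  ultimately show ?thesis by (simp only: mult_le_cancel_left_pos)
qed

text \<open>Integrating factor: \<open>exp (t\<^sup>2 / 2) * \<phi> t\<close> would be constantly 1
  for the exact equation, and its derivative measures the error. The mean value inequality bounds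
  the drift from 0 to \<open>t\<close>, and multiplying back cancels the exponential.\<close>

lemma phi_normal_bound: "norm (\<phi> t - of_real (exp (- (t\<^sup>2) / 2))) \<le> 100 * \<bar>t\<bar> * (1 + t\<^sup>2) / s"
proof -
  have s: "s \<ge> 1" by (rule s_ge_1)
  define w where "w a = complex_of_real (D a / s)" for a
  \<comment> \<open>\<open>p\<close> extends \<open>\<phi>\<close> to complex arguments, so that
    complex differentiation applies along the segment from 0 to \<open>t\<close>.\<close>
  define p where "p z = avg A (\<lambda>a. exp (\<i> * (z * w a)))" for z :: complex
  define q where "q z = avg A (\<lambda>a. w a * exp (\<i> * (z * w a)))" for z :: complex
  have p_real: "p (of_real u) = \<phi> u" for u
    by (simp add: p_def \<phi>_def w_def)
  have p0: "p 0 = 1"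
    by (simp add: p_def avg_const[OF fin ne])
  have dp: "(p has_field_derivative \<i> * q z) (at z within S)" for z S
    unfolding p_def q_def avg_def scaleR_conv_of_real
    by (auto intro!: derivative_eq_intros simp: sum_distrib_left mult_ac)
  define \<psi> where "\<psi> z = exp (z\<^sup>2 / 2) * p z" for z
  have d\<psi>: "(\<psi> has_field_derivative (exp (z\<^sup>2 / 2) * \<i> * (q z - \<i> * z * p z))) (at z within S)" for z S
  proof -
    have "((\<lambda>z. exp (z\<^sup>2 / 2)) has_field_derivative exp (z\<^sup>2 / 2) * z) (at z within S)"
      by (auto intro!: derivative_eq_intros)
    from DERIV_mult[OF this dp] show ?thesis
      unfolding \<psi>_def by (rule DERIV_cong) (simp add: algebra_simps)
  qed
  let ?B = "exp (t\<^sup>2 / 2) * (100 * (1 + t\<^sup>2) / s)"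
  have "norm (\<psi> (of_real t) - \<psi> 0) \<le> ?B * norm (of_real t - (0::complex))"
  proof (rule field_differentiable_bound[where S = "closed_segment 0 (of_real t)" and f' = "\<lambda>z. exp (z\<^sup>2 / 2) * \<i> * (q z - \<i> * z * p z)"])
    fix z :: complex assume "z \<in> closed_segment 0 (of_real t)"
    then obtain r where r: "0 \<le> r" "r \<le> 1" "z = of_real (r * t)"
      by (auto simp: in_segment scaleR_conv_of_real)
    define u where "u = r * t"
    have z: "z = of_real u" using r by (simp add: u_def)
    have "\<bar>u\<bar> \<le> \<bar>t\<bar>" using r by (simp add: u_def abs_mult mult_left_le_one_le)
    then have ut: "u\<^sup>2 \<le> t\<^sup>2" by (simp add: abs_le_square_iff)
    have "norm (exp (z\<^sup>2 / 2)) = exp (u\<^sup>2 / 2)"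
      unfolding z by (simp add: norm_exp_eq_Re)
    then have "norm (exp (z\<^sup>2 / 2)) \<le> exp (t\<^sup>2 / 2)" using ut by simp
    moreover have "norm (q z - \<i> * z * p z) \<le> 100 * (1 + u\<^sup>2) / s"
      using stein_char_bound[of u] unfolding z p_real by (simp add: q_def w_def)
    moreover have "100 * (1 + u\<^sup>2) / s \<le> 100 * (1 + t\<^sup>2) / s"
      using ut s by (intro divide_right_mono) auto
    ultimately show "norm (exp (z\<^sup>2 / 2) * \<i> * (q z - \<i> * z * p z)) \<le> ?B"
      unfolding norm_mult norm_ii mult_1_right by (intro mult_mono) auto
  qed (auto intro: d\<psi>)
  then have "norm (of_real (exp (t\<^sup>2 / 2)) * \<phi> t - 1) \<le> ?B * \<bar>t\<bar>"
    by (simp add: \<psi>_def p0 p_real flip: exp_of_real)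
  moreover have eq: "\<phi> t - of_real (exp (- (t\<^sup>2) / 2)) =
      of_real (exp (- (t\<^sup>2) / 2)) * (of_real (exp (t\<^sup>2 / 2)) * \<phi> t - 1)"
    by (simp add: algebra_simps exp_minus flip: of_real_mult)
  ultimately have "norm (\<phi> t - of_real (exp (- (t\<^sup>2) / 2))) \<le> exp (- (t\<^sup>2) / 2) * (?B * \<bar>t\<bar>)"
    unfolding eq norm_mult norm_of_real abs_exp_cancel by (intro mult_left_mono) auto
  also have "\<dots> = (exp (- (t\<^sup>2) / 2) * exp (t\<^sup>2 / 2)) * (100 * \<bar>t\<bar> * (1 + t\<^sup>2) / s)"
    by simp
  also have "exp (- (t\<^sup>2) / 2) * exp (t\<^sup>2 / 2) = 1"
    by (simp flip: exp_add)
  finally show ?thesis by simp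
qed

end

section \<open>Connectivity with high probability\<close>

lemma cubic_exchange_cubic_perms:
  "N \<ge> 1 \<Longrightarrow> cubic_exchange (cubic_perms {1..N}) (fixed_count {1..N}) N"
  using sum_cubic_perms_exchange[of "{1..N}", where 'b = complex] fixed_count_le[of "{1..N}"] id_in_cubic_perms
  by unfold_locales (auto simp: finite_cubic_perms)

lemma avg_fixed_count:
  "avg (cubic_perms {1..Suc m}) (\<lambda>v. real (fixed_count {1..Suc m} v)) * real (cubic_count (Suc m))
     = real (Suc m) * real (cubic_count m)"
proof -
  have "(\<Sum>v\<in>cubic_perms {1..Suc m}. real (fixed_count {1..Suc m} v)) = real (Suc m) * real (cubic_count m)"
    using arg_cong[OF sum_fixed_count[of "{1..Suc m}"], of real] by (simp add: algebra_simps)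
  moreover have "real (cubic_count (Suc m)) \<noteq> 0"
    using cubic_count_pos[of "Suc m"] by simp
  ultimately show ?thesis
    unfolding avg_def cubic_count_def[symmetric] by (simp del: of_nat_Suc)
qed

text \<open>The mean number of fixed points on \<open>Suc m\<close> points is \<open>Suc m\<close>
  times the inverse ratio of the counts, and it equals the cube root of \<open>Suc m\<close> up to a
  bounded error.\<close>

lemma cubic_count_ratio:
  "(\<lambda>m. real (cubic_count (Suc m)) / (real (cubic_count m) * real (Suc m) powr (2/3))) \<longlonglongrightarrow> 1"
proof -
  define E where "E m = avg (cubic_perms {1..Suc m}) (\<lambda>v. real (fixed_count {1..Suc m} v))" for m
  have E_eq: "E m * real (cubic_count (Suc m)) = real (Suc m) * real (cubic_count m)" for m
    unfolding E_def by (rule avg_fixed_count)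
  have pos: "real (cubic_count m) > 0" for m by (simp add: cubic_count_pos)
  \<comment> \<open>57 is the bound 56 on the mean of \<open>D\<close> plus the 1 in the centring
    \<open>\<kappa> + 1\<close>.\<close>
  have bound: "\<bar>E m - root 3 (real (Suc m))\<bar> \<le> 57" for m
  proof -
    interpret cubic_exchange "cubic_perms {1..Suc m}" "fixed_count {1..Suc m}" "Suc m"
      by (rule cubic_exchange_cubic_perms) simp
    show ?thesis
      using abs_avg_D_le avg_X unfolding E_def \<kappa>_def by linarith
  qed
  have "(\<lambda>m. E m / root 3 (real (Suc m)) - 1) \<longlonglongrightarrow> 0"
  proof (rule Lim_null_comparison[OF always_eventually])
    show "\<forall>m. norm (E m / root 3 (real (Suc m)) - 1) \<le> 57 / root 3 (real (Suc m))"
    proof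
      fix m
      have r: "root 3 (real (Suc m)) > 0" by simp
      then have "E m / root 3 (real (Suc m)) - 1 = (E m - root 3 (real (Suc m))) / root 3 (real (Suc m))"
        by (simp add: field_simps)
      then show "norm (E m / root 3 (real (Suc m)) - 1) \<le> 57 / root 3 (real (Suc m))"
        using bound[of m] r by (simp add: divide_right_mono)
    qed
    show "(\<lambda>m. 57 / root 3 (real (Suc m))) \<longlonglongrightarrow> 0" by real_asymp
  qed
  then have "(\<lambda>m. E m / root 3 (real (Suc m))) \<longlonglongrightarrow> 1" by (rule LIM_zero_cancel)
  then have "(\<lambda>m. inverse (E m / root 3 (real (Suc m)))) \<longlonglongrightarrow> inverse 1"
    by (rule tendsto_inverse) simp
  moreover have "inverse (E m / root 3 (real (Suc m))) =
      real (cubic_count (Suc m)) / (real (cubic_count m) * real (Suc m) powr (2/3))" for m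
  proof -
    define x y where "x = real (Suc m) powr (1/3)" and "y = real (Suc m) powr (2/3)"
    have xy: "x > 0" "y > 0" by (simp_all add: x_def y_def)
    have "real (Suc m) = x * y"
      by (simp add: x_def y_def flip: powr_add)
    then have "E m = x * y * real (cubic_count m) / real (cubic_count (Suc m))"
      using E_eq[of m] pos[of "Suc m"] by (simp only: field_simps)
    moreover have "root 3 (real (Suc m)) = x"
      by (simp add: x_def root_powr_inverse)
    ultimately show ?thesis
      using pos[of m] pos[of "Suc m"] xy unfolding y_def[symmetric] by (simp only:) (simp add: field_simps)
  qed
  ultimately show ?thesis by simp
qed

text \<open>From some \<open>J\<close> on, consecutive ratios lie between
  \<open>inverse (1 + e)\<close> and \<open>1 + e\<close>, and they telescope. The sum
  \<open>K\<close> of the terms up to \<open>J\<close> covers the beginning.\<close>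

lemma ratio_tendsto_1_imp_subexponential:
  fixes B :: "nat \<Rightarrow> real"
  assumes pos: "\<And>j. B j > 0" and lim: "(\<lambda>j. B (Suc j) / B j) \<longlonglongrightarrow> 1" and e: "e > 0"
  obtains K J where "K > 0" "\<And>j. B j \<le> K * (1 + e) ^ j" "\<And>m k. m \<ge> J \<Longrightarrow> B m \<le> (1 + e) ^ k * B (m + k)"
proof -
  have "\<forall>\<^sub>F j in sequentially. B (Suc j) / B j < 1 + e"
    using lim e by (intro order_tendstoD) auto
  moreover have "\<forall>\<^sub>F j in sequentially. B (Suc j) / B j > inverse (1 + e)"
    using lim e by (intro order_tendstoD) (auto simp: field_simps)
  ultimately have "\<forall>\<^sub>F j in sequentially. B (Suc j) / B j < 1 + e \<and> B (Suc j) / B j > inverse (1 + e)"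
    by eventually_elim auto
  then obtain J where J: "\<And>j. j \<ge> J \<Longrightarrow> B (Suc j) / B j < 1 + e \<and> B (Suc j) / B j > inverse (1 + e)"
    unfolding eventually_sequentially by blast
  define K where "K = (\<Sum>j\<le>J. B j)"
  have "K > 0" unfolding K_def using pos by (intro sum_pos) auto
  moreover have "B j \<le> K * (1 + e) ^ j" for j
  proof (induction j)
    case 0
    have "B 0 \<le> K" unfolding K_def by (rule member_le_sum) (auto simp: pos less_imp_le)
    then show ?case by simp
  next
    case (Suc j)
    show ?case
    proof (cases "Suc j \<le> J")
      case True
      then have "B (Suc j) \<le> K"
        unfolding K_def by (intro member_le_sum) (auto simp: pos less_imp_le)
      also have "\<dots> \<le> K * (1 + e) ^ Suc j"
        using \<open>K > 0\<close> e one_le_power[of "1 + e" "Suc j"] by (simp del: power_Suc)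
      finally show ?thesis .
    next
      case False
      then have "B (Suc j) / B j < 1 + e" using J[of j] by simp
      then have "B (Suc j) \<le> (1 + e) * B j" using pos[of j] by (simp add: field_simps)
      also have "\<dots> \<le> (1 + e) * (K * (1 + e) ^ j)" using Suc e by (intro mult_left_mono) auto
      finally show ?thesis by (simp add: mult_ac)
    qed
  qed
  moreover have "B m \<le> (1 + e) ^ k * B (m + k)" if "m \<ge> J" for m k
  proof (induction k)
    case 0
    then show ?case by simp
  next
    case (Suc k)
    have "B (Suc (m + k)) / B (m + k) > inverse (1 + e)" using J[of "m + k"] that by simp
    then have "B (m + k) \<le> (1 + e) * B (Suc (m + k))"
      using pos[of "m + k"] e by (simp add: field_simps)
    then have "(1 + e) ^ k * B (m + k) \<le> (1 + e) ^ k * ((1 + e) * B (Suc (m + k)))"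
      using e by (intro mult_left_mono) auto
    with Suc show ?case by (simp add: mult_ac)
  qed
  ultimately show ?thesis by (rule that)
qed

text \<open>The divisor is the predicted growth: adding two points to \<open>2 * j\<close>
  multiplies the count by about \<open>(2 * j + 2) powr (4/3)\<close>. What remains is
  subexponential.\<close>

definition norm_cubic_count :: "nat \<Rightarrow> real" where
  "norm_cubic_count j = real (cubic_count (2 * j)) / ((2 powr (4/3)) ^ j * fact j powr (4/3))"

lemma norm_cubic_count_pos: "norm_cubic_count j > 0"
  unfolding norm_cubic_count_def using cubic_count_pos by (intro divide_pos_pos mult_pos_pos) auto

text \<open>Two steps of the ratio asymptotics, from \<open>2 * j\<close> through
  \<open>2 * j + 1\<close> to \<open>2 * j + 2\<close>; the last factor corrects for the odd
  step.\<close>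

lemma norm_cubic_count_ratio:
  "(\<lambda>j. norm_cubic_count (Suc j) / norm_cubic_count j) \<longlonglongrightarrow> 1"
proof -
  define R where "R m = real (cubic_count (Suc m)) / (real (cubic_count m) * real (Suc m) powr (2/3))" for m
  have R: "R \<longlonglongrightarrow> 1" unfolding R_def by (rule cubic_count_ratio)
  have "strict_mono (\<lambda>j::nat. 2 * j)" "strict_mono (\<lambda>j::nat. 2 * j + 1)"
    by (auto simp: strict_mono_def)
  from LIMSEQ_subseq_LIMSEQ[OF R this(1)] LIMSEQ_subseq_LIMSEQ[OF R this(2)]
  have R2: "(\<lambda>j. R (2 * j)) \<longlonglongrightarrow> 1" "(\<lambda>j. R (2 * j + 1)) \<longlonglongrightarrow> 1"
    by (simp_all add: o_def)
  have lim: "(\<lambda>j. (real (2 * j + 1) / real (2 * j + 2)) powr (2/3)) \<longlonglongrightarrow> 1"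
    by real_asymp
  have "norm_cubic_count (Suc j) / norm_cubic_count j =
      R (2 * j) * R (2 * j + 1) * (real (2 * j + 1) / real (2 * j + 2)) powr (2/3)" for j
  proof -
    have pos: "real (cubic_count m) > 0" for m by (simp add: cubic_count_pos)
    define x y where "x = real (2 * j + 1)" and "y = real (2 * j + 2)"
    have xy: "x > 0" "y > 0" by (simp_all add: x_def y_def)
    have f: "fact (Suc j) powr (4/3) = real (Suc j) powr (4/3) * fact j powr (4/3 :: real)"
      by (simp add: powr_mult del: of_nat_Suc)
    have y: "2 powr (4/3) * real (Suc j) powr (4/3) = y powr (4/3)"
      by (simp add: y_def flip: powr_mult)
    have y2: "y powr (4/3) = y powr (2/3) * y powr (2/3)"
      by (simp flip: powr_add)
    have "norm_cubic_count (Suc j) / norm_cubic_count j =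
        real (cubic_count (2 * j + 2)) / (real (cubic_count (2 * j)) * (2 powr (4/3) * real (Suc j) powr (4/3)))"
      using pos[of "2 * j"] unfolding norm_cubic_count_def f by (simp add: field_simps)
    also have "\<dots> = real (cubic_count (2 * j + 2)) / (real (cubic_count (2 * j)) * (y powr (2/3) * y powr (2/3)))"
      unfolding y y2 ..
    also have "\<dots> = (real (cubic_count (2 * j + 1)) / (real (cubic_count (2 * j)) * x powr (2/3))) *
       (real (cubic_count (2 * j + 2)) / (real (cubic_count (2 * j + 1)) * y powr (2/3))) * (x powr (2/3) / y powr (2/3))"
      using pos[of "2 * j + 1"] xy by (simp add: field_simps)
    also have "x powr (2/3) / y powr (2/3) = (x / y) powr (2/3)"
      using xy by (simp add: powr_divide)
    finally show ?thesis by (simp add: R_def x_def y_def algebra_simps)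
  qed
  then show ?thesis
    using tendsto_mult[OF tendsto_mult[OF R2] lim] by simp
qed

text \<open>The powers of 2 cancel, and the factorials give the binomial coefficient to the power
  \<open>- 4/3\<close>. Together with the binomial coefficient in front, the exponent is
  \<open>- 1/3\<close>.\<close>

lemma split_term_eq:
  assumes "j \<le> n"
  shows "real (n choose j) * (real (cubic_count (2 * j)) * real (cubic_count (2 * n - 2 * j))) / real (cubic_count (2 * n))
     = norm_cubic_count j * norm_cubic_count (n - j) / norm_cubic_count n / real (n choose j) powr (1/3)"
proof -
  define c where "c = (2 :: real) powr (4/3)"
  have c: "c > 0" by (simp add: c_def)
  have cc: "real (cubic_count (2 * k)) = norm_cubic_count k * (c ^ k * fact k powr (4/3))" for k
    by (simp add: norm_cubic_count_def c_def)
  have pos: "real (n choose j) > 0" using assms by simp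
  have "c ^ n = c ^ j * c ^ (n - j)" using assms by (simp flip: power_add)
  moreover have "(fact n :: real) = real (n choose j) * (fact j * fact (n - j))"
    unfolding binomial_fact[OF assms] by simp
  then have "(fact n :: real) powr (4/3) = real (n choose j) powr (4/3) * (fact j powr (4/3) * fact (n - j) powr (4/3))"
    by (simp only: powr_mult)
  moreover have "real (n choose j) powr (4/3) = real (n choose j) * real (n choose j) powr (1/3)"
    using pos by (simp add: powr_mult_base)
  moreover have "2 * n - 2 * j = 2 * (n - j)" by simp
  ultimately show ?thesis
    using c pos norm_cubic_count_pos[of n] by (simp only: cc) (simp add: field_simps)
qed

text \<open>The first bound supplies decay in \<open>n\<close>, the second geometric decay in
  \<open>j\<close>.\<close>

lemma binomial_ge_n_and_pow2:
  assumes "1 \<le> j" "2 * j \<le> n"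
  shows "n \<le> n choose j" "2 ^ j \<le> n choose j"
proof -
  show "n \<le> n choose j"
    using binomial_mono[of 1 j n] assms by simp
  have "(2 :: real) ^ j \<le> (real n / real j) ^ j"
    using assms by (intro power_mono) (auto simp: field_simps)
  also have "\<dots> \<le> real (n choose j)"
    using assms by (intro binomial_ge_n_over_k_pow_k) auto
  finally show "2 ^ j \<le> n choose j"
    by (simp flip: of_nat_le_iff)
qed

lemma disconnected_fraction_tendsto_0:
  "(\<lambda>n. real (card (all_pairs n - maps13 n)) / real (card (all_pairs n))) \<longlonglongrightarrow> 0"
proof -
  \<comment> \<open>With \<open>e = 1/20\<close> the subexponential factors cost at most
    \<open>(21/20)\<^sup>2\<close> per step in \<open>j\<close>, which is less than 59/50, a lower
    bound for the fourth root of 2. The quotient is below 19/20.\<close>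
  obtain K J where K: "K > 0" and B1: "\<And>j. norm_cubic_count j \<le> K * (1 + 1/20) ^ j"
    and B2: "\<And>m k. m \<ge> J \<Longrightarrow> norm_cubic_count m \<le> (1 + 1/20) ^ k * norm_cubic_count (m + k)"
    by (rule ratio_tendsto_1_imp_subexponential[where B = norm_cubic_count and e = "1/20",
        OF norm_cubic_count_pos norm_cubic_count_ratio]) (simp, rule that)
  have "(59/50 :: real) = ((59/50) powr 4) powr (1/4)"
    unfolding powr_powr by simp
  also have "(59/50 :: real) powr 4 = (59/50) ^ 4"
    by (rule powr_numeral) simp
  also have "((59/50 :: real) ^ 4) powr (1/4) \<le> 2 powr (1/4)"
    by (rule powr_mono2) (auto simp: power_divide)
  finally have two: "(59/50 :: real) \<le> 2 powr (1/4)" .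
  have "real (card (all_pairs n - maps13 n)) / real (card (all_pairs n)) \<le> 20 * K / real n powr (1/12)"
    if n: "n \<ge> 2 * J + 1" for n
  proof -
    have term_le: "real (n choose j) * (real (cubic_count (2 * j)) * real (cubic_count (2 * n - 2 * j))) / real (cubic_count (2 * n))
        \<le> K / real n powr (1/12) * (19/20) ^ j" if j: "j \<in> {1..n div 2}" for j
    proof -
      have j': "1 \<le> j" "2 * j \<le> n" using j by auto
      then have "j \<le> n" by simp
      define C where "C = real (n choose j)"
      have C: "real n \<le> C" "2 ^ j \<le> C" "C > 0"
        using binomial_ge_n_and_pow2[OF j'] \<open>j \<le> n\<close> unfolding C_def
        by (simp_all flip: of_nat_le_iff)
      \<comment> \<open>Since \<open>j\<close> is at most half of \<open>n\<close>, the assumption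
        on \<open>n\<close> puts \<open>n - j\<close> beyond \<open>J\<close>.\<close>
      have "norm_cubic_count (n - j) \<le> (1 + 1/20) ^ j * norm_cubic_count n"
        using B2[of "n - j" j] n j' by simp
      then have "norm_cubic_count (n - j) / norm_cubic_count n \<le> (1 + 1/20) ^ j"
        using norm_cubic_count_pos[of n] by (simp add: field_simps)
      then have "norm_cubic_count j * (norm_cubic_count (n - j) / norm_cubic_count n) \<le> K * (1 + 1/20) ^ j * (1 + 1/20) ^ j"
        using K norm_cubic_count_pos by (intro mult_mono B1) (auto intro: less_imp_le divide_pos_pos)
      also have "\<dots> = K * ((21/20)\<^sup>2) ^ j"
      proof -
        have "(1 + 1/20 :: real) = 21/20" by simp
        then show ?thesis by (simp only: power2_eq_square power_mult_distrib mult.assoc)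
      qed
      finally have num: "norm_cubic_count j * norm_cubic_count (n - j) / norm_cubic_count n \<le> K * ((21/20)\<^sup>2) ^ j"
        by simp
      \<comment> \<open>The exponent 1/3 is split as 1/12 + 1/4: one part of \<open>C\<close> pays
        for uniform decay in \<open>n\<close>, the other for summability over
        \<open>j\<close>.\<close>
      have "real n powr (1/12) * (59/50) ^ j \<le> C powr (1/12) * C powr (1/4)"
      proof (rule mult_mono)
        show "real n powr (1/12) \<le> C powr (1/12)" using C by (intro powr_mono2) auto
        have "(59/50 :: real) ^ j \<le> (2 powr (1/4)) ^ j" using two by (intro power_mono) auto
        also have "\<dots> = (2 ^ j) powr (1/4)"
          by (simp add: powr_power powr_powr mult.commute powr_realpow[symmetric])
        also have "\<dots> \<le> C powr (1/4)" using C by (intro powr_mono2) auto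
        finally show "(59/50 :: real) ^ j \<le> C powr (1/4)" .
      qed auto
      also have "\<dots> = C powr (1/3)" by (simp flip: powr_add)
      finally have den: "real n powr (1/12) * (59/50) ^ j \<le> C powr (1/3)" .
      have "norm_cubic_count j * norm_cubic_count (n - j) / norm_cubic_count n / C powr (1/3) \<le>
          (K * ((21/20)\<^sup>2) ^ j) / (real n powr (1/12) * (59/50) ^ j)"
        using num den K n by (intro frac_le) auto
      also have "\<dots> = K / real n powr (1/12) * (((21/20)\<^sup>2) ^ j / (59/50) ^ j)"
        by simp
      also have "((21/20)\<^sup>2) ^ j / (59/50) ^ j = ((21/20)\<^sup>2 / (59/50) :: real) ^ j"
        by (rule power_divide[symmetric])
      also have "K / real n powr (1/12) * \<dots> \<le> K / real n powr (1/12) * (19/20) ^ j"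
        using K by (intro mult_left_mono power_mono) (auto simp: power2_eq_square)
      finally show ?thesis
        unfolding split_term_eq[OF \<open>j \<le> n\<close>] C_def .
    qed
    have "real (card (all_pairs n - maps13 n)) / real (card (all_pairs n)) \<le>
        (\<Sum>j=1..n div 2. K / real n powr (1/12) * (19/20) ^ j)"
      by (rule order_trans[OF disconnected_fraction_le sum_mono[OF term_le]])
    also have "\<dots> = K / real n powr (1/12) * (\<Sum>j=1..n div 2. (19/20) ^ j)"
      by (simp only: sum_distrib_left)
    also have "\<dots> \<le> K / real n powr (1/12) * 20"
    proof (rule mult_left_mono)
      have "(\<Sum>j=1..n div 2. (19/20 :: real) ^ j) \<le> (\<Sum>j. (19/20) ^ j)"
        by (rule sum_le_suminf) (auto intro: summable_geometric)
      also have "(\<Sum>j. (19/20 :: real) ^ j) = 20"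
        by (subst suminf_geometric) auto
      finally show "(\<Sum>j=1..n div 2. (19/20 :: real) ^ j) \<le> 20" .
    qed (use K in simp)
    finally show ?thesis by (simp add: mult_ac)
  qed
  then have "\<forall>\<^sub>F n in sequentially. norm (real (card (all_pairs n - maps13 n)) / real (card (all_pairs n)))
      \<le> 20 * K / real n powr (1/12)"
    by (intro eventually_sequentiallyI[of "2 * J + 1"]) simp
  moreover have "(\<lambda>n. 20 * K / real n powr (1/12)) \<longlonglongrightarrow> 0" by real_asymp
  ultimately show ?thesis by (rule Lim_null_comparison)
qed

section \<open>The limit theorem\<close>

lemma avg_subset:
  fixes f :: "'a \<Rightarrow> 'b::real_normed_field"
  assumes "finite P" "M \<subseteq> P"
  shows "of_real (real (card M) / real (card P)) * avg M f = avg P f - of_real (inverse (real (card P))) * (\<Sum>x\<in>P - M. f x)"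
proof (cases "M = {}")
  case False
  then have "card M > 0" using assms finite_subset by (auto simp: card_gt_0_iff)
  moreover have "sum f P = sum f (P - M) + sum f M"
    using assms by (rule sum.subset_diff[rotated])
  ultimately show ?thesis
    by (simp add: avg_def scaleR_conv_of_real divide_inverse algebra_simps of_real_inverse)
qed (simp add: avg_def scaleR_conv_of_real)

text \<open>Only the sum over \<open>P - M\<close> is lost. By Cauchy-Schwarz it is controlled by
  the proportion of \<open>P - M\<close> and the second moment of \<open>f\<close> over all of
  \<open>P\<close>.\<close>

lemma avg_subset_Cauchy_Schwarz:
  fixes f :: "'a \<Rightarrow> real"
  assumes "finite P" "M \<subseteq> P"
  shows "\<bar>real (card M) / real (card P) * avg M f - avg P f\<bar>
    \<le> sqrt (real (card (P - M)) / real (card P) * avg P (\<lambda>x. (f x)\<^sup>2))"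
proof -
  let ?c = "real (card P)"
  have "(\<Sum>x\<in>P - M. f x)\<^sup>2 \<le> (\<Sum>x\<in>P - M. (f x)\<^sup>2) * real (card (P - M))"
    using sum_squared_le_sum_of_squares[of f "P - M"] by (simp add: mult.commute)
  also have "\<dots> \<le> (\<Sum>x\<in>P. (f x)\<^sup>2) * real (card (P - M))"
    using assms by (intro mult_right_mono sum_mono2) auto
  finally have "(inverse ?c * (\<Sum>x\<in>P - M. f x))\<^sup>2 \<le>
      (inverse ?c)\<^sup>2 * ((\<Sum>x\<in>P. (f x)\<^sup>2) * real (card (P - M)))"
    unfolding power_mult_distrib by (rule mult_left_mono) simp
  also have "\<dots> = real (card (P - M)) / ?c * avg P (\<lambda>x. (f x)\<^sup>2)"
    by (simp add: avg_def power2_eq_square divide_inverse)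
  finally have "\<bar>inverse ?c * (\<Sum>x\<in>P - M. f x)\<bar> \<le> sqrt (real (card (P - M)) / ?c * avg P (\<lambda>x. (f x)\<^sup>2))"
    by (simp add: real_le_rsqrt)
  then show ?thesis
    using avg_subset[OF assms, of f] by simp
qed

lemma avg_subset_bounded:
  fixes f :: "'a \<Rightarrow> 'b::real_normed_field"
  assumes "finite P" "M \<subseteq> P" "\<And>x. norm (f x) \<le> 1"
  shows "norm (of_real (real (card M) / real (card P)) * avg M f - avg P f)
    \<le> real (card (P - M)) / real (card P)"
proof -
  have "norm (\<Sum>x\<in>P - M. f x) \<le> real (card (P - M)) * 1"
    using assms(3) by (intro sum_norm_bound)
  then have "inverse (real (card P)) * norm (\<Sum>x\<in>P - M. f x) \<le> inverse (real (card P)) * real (card (P - M))"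
    by (intro mult_left_mono) auto
  then show ?thesis
    unfolding avg_subset[OF assms(1,2)] by (simp add: norm_mult norm_inverse divide_inverse mult.commute)
qed

text \<open>Carries a limit from all pairs, \<open>b\<close>, to connected maps, \<open>a\<close>,
  where \<open>q\<close> is the connected fraction. Division by \<open>q\<close> is legitimate once
  \<open>q\<close> exceeds 1/2.\<close>

lemma tendsto_of_perturbed_multiple:
  fixes a b :: "nat \<Rightarrow> 'b::real_normed_field" and q c :: "nat \<Rightarrow> real"
  assumes q: "q \<longlonglongrightarrow> 1" and c: "c \<longlonglongrightarrow> 0" and b: "b \<longlonglongrightarrow> L"
    and le: "\<forall>\<^sub>F n in sequentially. norm (of_real (q n) * a n - b n) \<le> c n"
  shows "a \<longlonglongrightarrow> L"
proof -
  have "(\<lambda>n. of_real (q n) * a n - b n) \<longlonglongrightarrow> 0"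
    by (rule Lim_null_comparison[OF le c])
  from tendsto_add[OF this b] have "(\<lambda>n. of_real (q n) * a n) \<longlonglongrightarrow> L" by simp
  from tendsto_divide[OF this tendsto_of_real[OF q]]
  have "(\<lambda>n. of_real (q n) * a n / of_real (q n)) \<longlonglongrightarrow> L" by simp
  moreover have "\<forall>\<^sub>F n in sequentially. q n > 1/2"
    using q by (rule order_tendstoD) simp
  then have "\<forall>\<^sub>F n in sequentially. of_real (q n) * a n / of_real (q n) = a n"
    by eventually_elim simp
  ultimately show ?thesis by (rule Lim_transform_eventually)
qed

section \<open>From all pairs to connected maps\<close>

lemma maps13_subset: "maps13 n \<subseteq> all_pairs n"
  by (auto simp: maps13_eq)

lemma finite_maps13: "finite (maps13 n)"
  using maps13_subset finite_all_pairs by (rule finite_subset)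

lemma connected_fraction_tendsto_1: "(\<lambda>n. real (card (maps13 n)) / real (card (all_pairs n))) \<longlonglongrightarrow> 1"
proof -
  have "real (card (maps13 n)) / real (card (all_pairs n)) =
      1 - real (card (all_pairs n - maps13 n)) / real (card (all_pairs n))" for n
  proof -
    have "card (maps13 n) \<le> card (all_pairs n)"
      by (rule card_mono[OF finite_all_pairs maps13_subset])
    then show ?thesis
      using card_all_pairs_pos[of n]
      by (simp add: card_Diff_subset[OF finite_maps13 maps13_subset] of_nat_diff field_simps)
  qed
  then show ?thesis
    using tendsto_diff[OF tendsto_const[of 1] disconnected_fraction_tendsto_0] by simp
qed

text \<open>A by-product of the connected fraction tending to 1, enough for statements about
  limits.\<close>

lemma eventually_maps13_nonempty: "\<forall>\<^sub>F n in sequentially. maps13 n \<noteq> {}"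
proof -
  have "\<forall>\<^sub>F n in sequentially. real (card (maps13 n)) / real (card (all_pairs n)) > 0"
    using connected_fraction_tendsto_1 by (rule order_tendstoD) simp
  then show ?thesis by eventually_elim auto
qed

lemma expectation_random_map13:
  fixes f :: "_ \<Rightarrow> 'b::{banach, second_countable_topology}"
  assumes "maps13 n \<noteq> {}"
  shows "measure_pmf.expectation (random_map13 n) f = avg (maps13 n) f"
  unfolding random_map13_def avg_def scaleR_sum_right
  using assms finite_maps13
  by (subst integral_measure_pmf[of "maps13 n"]) (auto simp: divide_inverse intro!: sum.cong)

text \<open>Each \<open>v\<close> is paired with the same number of matchings, so \<open>v\<close>
  alone is uniform.\<close>

lemma avg_all_pairs: "avg (all_pairs n) (\<lambda>m. f (fst m)) = avg (cubic_perms {1..2 * n}) f"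
proof -
  have "(\<Sum>m\<in>all_pairs n. f (fst m)) = (\<Sum>v\<in>cubic_perms {1..2 * n}. \<Sum>e\<in>matchings {1..2 * n}. f v)"
    unfolding all_pairs_def sum.cartesian_product by (rule sum.cong) auto
  also have "\<dots> = real (matching_count (2 * n)) *\<^sub>R (\<Sum>v\<in>cubic_perms {1..2 * n}. f v)"
    by (simp add: sum_constant_scaleR matching_count_def scaleR_sum_right)
  finally show ?thesis
    using matching_count_pos[of n]
    by (simp add: avg_def card_all_pairs card_cubic_perms)
qed

definition cbrt2n :: "nat \<Rightarrow> real" where
  "cbrt2n n = root 3 (2 * real n)"

text \<open>The deviation \<open>D\<close> for \<open>N = 2 * n\<close>, read off the vertex
  permutation and so available outside the locale.\<close>

definition dev :: "nat \<Rightarrow> (nat \<Rightarrow> nat) \<times> (nat \<Rightarrow> nat) \<Rightarrow> real" where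
  "dev n m = real (fixed_count {1..2 * n} (fst m)) - 1 - cbrt2n n"

lemma dev_estimates:
  assumes "n \<ge> 1"
  shows "\<bar>avg (all_pairs n) (dev n)\<bar> \<le> 56"
    and "\<bar>avg (all_pairs n) (\<lambda>m. (dev n m)\<^sup>2) - cbrt2n n\<bar> \<le> 320 * sqrt (cbrt2n n)"
    and "avg (all_pairs n) (\<lambda>m. (dev n m)\<^sup>2) \<le> 7 * cbrt2n n"
    and "avg (all_pairs n) (\<lambda>m. (dev n m) ^ 4) \<le> 280 * (cbrt2n n)\<^sup>2"
    and "norm (avg (all_pairs n) (\<lambda>m. iexp (t * (dev n m / sqrt (cbrt2n n)))) - of_real (exp (- (t\<^sup>2) / 2)))
       \<le> 100 * \<bar>t\<bar> * (1 + t\<^sup>2) / sqrt (cbrt2n n)"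
proof -
  interpret cubic_exchange "cubic_perms {1..2 * n}" "fixed_count {1..2 * n}" "2 * n"
    by (rule cubic_exchange_cubic_perms) (use assms in simp)
  have k: "cbrt2n n = \<kappa>" by (simp add: cbrt2n_def \<kappa>_def)
  have d: "dev n m = D (fst m)" for m unfolding dev_def D_def k ..
  have transfer: "avg (all_pairs n) (\<lambda>m. f (dev n m)) = avg (cubic_perms {1..2 * n}) (\<lambda>v. f (D v))"
    for f :: "real \<Rightarrow> 'x::real_vector"
    unfolding d by (rule avg_all_pairs)
  show "\<bar>avg (all_pairs n) (dev n)\<bar> \<le> 56"
    using transfer[of "\<lambda>x. x"] abs_avg_D_le by simp
  show "\<bar>avg (all_pairs n) (\<lambda>m. (dev n m)\<^sup>2) - cbrt2n n\<bar> \<le> 320 * sqrt (cbrt2n n)"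
    using transfer[of "\<lambda>x. x\<^sup>2"] abs_avg_D_squared_diff_le by (simp add: k s_def)
  show "avg (all_pairs n) (\<lambda>m. (dev n m)\<^sup>2) \<le> 7 * cbrt2n n"
    using transfer[of "\<lambda>x. x\<^sup>2"] avg_D_squared_le by (simp add: k)
  show "avg (all_pairs n) (\<lambda>m. (dev n m) ^ 4) \<le> 280 * (cbrt2n n)\<^sup>2"
    using transfer[of "\<lambda>x. x ^ 4"] avg_D_fourth_le by (simp add: k)
  show "norm (avg (all_pairs n) (\<lambda>m. iexp (t * (dev n m / sqrt (cbrt2n n)))) - of_real (exp (- (t\<^sup>2) / 2)))
       \<le> 100 * \<bar>t\<bar> * (1 + t\<^sup>2) / sqrt (cbrt2n n)"
    using phi_normal_bound[of t] unfolding transfer[of "\<lambda>x. iexp (t * (x / sqrt (cbrt2n n)))"]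
    by (simp only: \<phi>_def s_def k)
qed

lemma cbrt2n_at_top: "filterlim cbrt2n at_top sequentially"
  unfolding cbrt2n_def by real_asymp

lemma inverse_cbrt2n_limits:
  "(\<lambda>n. c / cbrt2n n) \<longlonglongrightarrow> 0" "(\<lambda>n. c / sqrt (cbrt2n n)) \<longlonglongrightarrow> 0"
proof -
  have "filterlim (\<lambda>n. sqrt (cbrt2n n)) at_top sequentially"
    by (rule filterlim_compose[OF sqrt_at_top cbrt2n_at_top])
  then show "(\<lambda>n. c / cbrt2n n) \<longlonglongrightarrow> 0" "(\<lambda>n. c / sqrt (cbrt2n n)) \<longlonglongrightarrow> 0"
    using cbrt2n_at_top by (auto intro!: real_tendsto_divide_at_top tendsto_const)
qed

lemma cbrt2n_pos: "n \<ge> 1 \<Longrightarrow> cbrt2n n > 0"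
  by (simp add: cbrt2n_def)

lemma sqrt_disconnected_fraction:
  "(\<lambda>n. sqrt (real (card (all_pairs n - maps13 n)) / real (card (all_pairs n)) * c)) \<longlonglongrightarrow> 0"
  using tendsto_real_sqrt[OF tendsto_mult_left_zero[OF disconnected_fraction_tendsto_0, of c]] by simp

text \<open>Over all pairs the mean deviation is bounded. By Cauchy-Schwarz and the second moment
  bound, discarding disconnected pairs costs at most the vanishing factor
  \<open>sqrt (?p * 7)\<close> after scaling.\<close>

lemma avg_dev_limit: "(\<lambda>n. avg (maps13 n) (dev n) / sqrt (cbrt2n n)) \<longlonglongrightarrow> 0"
proof (rule tendsto_of_perturbed_multiple[OF connected_fraction_tendsto_1 sqrt_disconnected_fraction[of 7]])
  show "(\<lambda>n. avg (all_pairs n) (dev n) / sqrt (cbrt2n n)) \<longlonglongrightarrow> 0"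
  proof (rule Lim_null_comparison[OF _ inverse_cbrt2n_limits(2)[of 56]])
    show "\<forall>\<^sub>F n in sequentially. norm (avg (all_pairs n) (dev n) / sqrt (cbrt2n n)) \<le> 56 / sqrt (cbrt2n n)"
      using eventually_ge_at_top[of 1]
    proof eventually_elim
      case (elim n)
      then show ?case
        using dev_estimates(1)[OF elim] cbrt2n_pos[OF elim] by (simp add: divide_right_mono abs_divide)
    qed
  qed
  show "\<forall>\<^sub>F n in sequentially. norm (of_real (real (card (maps13 n)) / real (card (all_pairs n))) *
      (avg (maps13 n) (dev n) / sqrt (cbrt2n n)) - avg (all_pairs n) (dev n) / sqrt (cbrt2n n))
      \<le> sqrt (real (card (all_pairs n - maps13 n)) / real (card (all_pairs n)) * 7)"
    using eventually_ge_at_top[of 1]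
  proof eventually_elim
    case (elim n)
    let ?q = "real (card (maps13 n)) / real (card (all_pairs n))"
    let ?p = "real (card (all_pairs n - maps13 n)) / real (card (all_pairs n))"
    have k: "cbrt2n n > 0" by (rule cbrt2n_pos[OF elim])
    have "\<bar>?q * avg (maps13 n) (dev n) - avg (all_pairs n) (dev n)\<bar> \<le> sqrt (?p * avg (all_pairs n) (\<lambda>m. (dev n m)\<^sup>2))"
      by (rule avg_subset_Cauchy_Schwarz[OF finite_all_pairs maps13_subset])
    also have "\<dots> \<le> sqrt (?p * 7 * cbrt2n n)"
      unfolding mult.assoc by (intro real_sqrt_le_mono mult_left_mono dev_estimates(3)[OF elim]) auto
    also have "\<dots> = sqrt (?p * 7) * sqrt (cbrt2n n)" by (rule real_sqrt_mult)
    finally have "\<bar>?q * avg (maps13 n) (dev n) - avg (all_pairs n) (dev n)\<bar> / sqrt (cbrt2n n) \<le> sqrt (?p * 7)"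
      using k by (simp add: pos_divide_le_eq)
    moreover have "?q * (avg (maps13 n) (dev n) / sqrt (cbrt2n n)) - avg (all_pairs n) (dev n) / sqrt (cbrt2n n)
        = (?q * avg (maps13 n) (dev n) - avg (all_pairs n) (dev n)) / sqrt (cbrt2n n)"
      by (simp add: diff_divide_distrib)
    ultimately show ?case
      using k by (simp only: of_real_eq_id id_apply real_norm_def abs_divide) simp
  qed
qed

text \<open>The same transfer for the squared deviation; here Cauchy-Schwarz calls for the fourth
  moment, whence the constant 280.\<close>

lemma avg_dev_squared_limit: "(\<lambda>n. avg (maps13 n) (\<lambda>m. (dev n m)\<^sup>2) / cbrt2n n) \<longlonglongrightarrow> 1"
proof (rule tendsto_of_perturbed_multiple[OF connected_fraction_tendsto_1 sqrt_disconnected_fraction[of 280]])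
  have "(\<lambda>n. avg (all_pairs n) (\<lambda>m. (dev n m)\<^sup>2) / cbrt2n n - 1) \<longlonglongrightarrow> 0"
  proof (rule Lim_null_comparison[OF _ inverse_cbrt2n_limits(2)[of 320]])
    show "\<forall>\<^sub>F n in sequentially. norm (avg (all_pairs n) (\<lambda>m. (dev n m)\<^sup>2) / cbrt2n n - 1) \<le> 320 / sqrt (cbrt2n n)"
      using eventually_ge_at_top[of 1]
    proof eventually_elim
      case (elim n)
      have k: "cbrt2n n > 0" by (rule cbrt2n_pos[OF elim])
      have "avg (all_pairs n) (\<lambda>m. (dev n m)\<^sup>2) / cbrt2n n - 1 =
          (avg (all_pairs n) (\<lambda>m. (dev n m)\<^sup>2) - cbrt2n n) / cbrt2n n"
        using k by (simp add: field_simps)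
      also have "norm \<dots> \<le> 320 * sqrt (cbrt2n n) / cbrt2n n"
        using dev_estimates(2)[OF elim] k by (simp add: divide_right_mono)
      also have "\<dots> = 320 / sqrt (cbrt2n n)"
        using k by (simp add: divide_simps)
      finally show ?case .
    qed
  qed
  then show "(\<lambda>n. avg (all_pairs n) (\<lambda>m. (dev n m)\<^sup>2) / cbrt2n n) \<longlonglongrightarrow> 1"
    by (rule LIM_zero_cancel)
  show "\<forall>\<^sub>F n in sequentially. norm (of_real (real (card (maps13 n)) / real (card (all_pairs n))) *
      (avg (maps13 n) (\<lambda>m. (dev n m)\<^sup>2) / cbrt2n n) - avg (all_pairs n) (\<lambda>m. (dev n m)\<^sup>2) / cbrt2n n)
      \<le> sqrt (real (card (all_pairs n - maps13 n)) / real (card (all_pairs n)) * 280)"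
    using eventually_ge_at_top[of 1]
  proof eventually_elim
    case (elim n)
    let ?q = "real (card (maps13 n)) / real (card (all_pairs n))"
    let ?p = "real (card (all_pairs n - maps13 n)) / real (card (all_pairs n))"
    let ?f = "\<lambda>m. (dev n m)\<^sup>2"
    have k: "cbrt2n n > 0" by (rule cbrt2n_pos[OF elim])
    have "\<bar>?q * avg (maps13 n) ?f - avg (all_pairs n) ?f\<bar> \<le> sqrt (?p * avg (all_pairs n) (\<lambda>m. (?f m)\<^sup>2))"
      by (rule avg_subset_Cauchy_Schwarz[OF finite_all_pairs maps13_subset])
    also have "\<dots> = sqrt (?p * avg (all_pairs n) (\<lambda>m. (dev n m) ^ 4))"
      by (simp flip: power_mult)
    also have "\<dots> \<le> sqrt (?p * 280 * (cbrt2n n)\<^sup>2)"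
      unfolding mult.assoc by (intro real_sqrt_le_mono mult_left_mono dev_estimates(4)[OF elim]) auto
    also have "\<dots> = sqrt (?p * 280) * cbrt2n n"
      using k by (subst real_sqrt_mult) simp
    finally have "\<bar>?q * avg (maps13 n) ?f - avg (all_pairs n) ?f\<bar> / cbrt2n n \<le> sqrt (?p * 280)"
      using k by (simp add: pos_divide_le_eq)
    moreover have "?q * (avg (maps13 n) ?f / cbrt2n n) - avg (all_pairs n) ?f / cbrt2n n
        = (?q * avg (maps13 n) ?f - avg (all_pairs n) ?f) / cbrt2n n"
      by (simp add: diff_divide_distrib)
    ultimately show ?case
      using k by (simp only: of_real_eq_id id_apply real_norm_def abs_divide abs_of_pos)
  qed
qed

text \<open>The summands have modulus 1, so conditioning costs at most the disconnected
  fraction.\<close>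

lemma avg_iexp_limit:
  "(\<lambda>n. avg (maps13 n) (\<lambda>m. iexp (t * (dev n m / sqrt (cbrt2n n))))) \<longlonglongrightarrow> of_real (exp (- (t\<^sup>2) / 2))"
proof (rule tendsto_of_perturbed_multiple[OF connected_fraction_tendsto_1 disconnected_fraction_tendsto_0])
  have "(\<lambda>n. avg (all_pairs n) (\<lambda>m. iexp (t * (dev n m / sqrt (cbrt2n n)))) - of_real (exp (- (t\<^sup>2) / 2))) \<longlonglongrightarrow> 0"
  proof (rule Lim_null_comparison[OF _ inverse_cbrt2n_limits(2)[of "100 * \<bar>t\<bar> * (1 + t\<^sup>2)"]])
    show "\<forall>\<^sub>F n in sequentially. norm (avg (all_pairs n) (\<lambda>m. iexp (t * (dev n m / sqrt (cbrt2n n)))) -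
        of_real (exp (- (t\<^sup>2) / 2))) \<le> 100 * \<bar>t\<bar> * (1 + t\<^sup>2) / sqrt (cbrt2n n)"
      using eventually_ge_at_top[of 1] by eventually_elim (rule dev_estimates(5))
  qed
  then show "(\<lambda>n. avg (all_pairs n) (\<lambda>m. iexp (t * (dev n m / sqrt (cbrt2n n))))) \<longlonglongrightarrow> of_real (exp (- (t\<^sup>2) / 2))"
    by (rule LIM_zero_cancel)
  show "\<forall>\<^sub>F n in sequentially. norm (of_real (real (card (maps13 n)) / real (card (all_pairs n))) *
      avg (maps13 n) (\<lambda>m. iexp (t * (dev n m / sqrt (cbrt2n n)))) -
      avg (all_pairs n) (\<lambda>m. iexp (t * (dev n m / sqrt (cbrt2n n)))))
      \<le> real (card (all_pairs n - maps13 n)) / real (card (all_pairs n))"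
    by (intro always_eventually allI avg_subset_bounded[OF finite_all_pairs maps13_subset]) simp
qed

section \<open>Mean, variance and limit law\<close>

lemma num_univalent_dev:
  assumes "m \<in> maps13 n"
  shows "real (num_univalent n m) = cbrt2n n + 1 + dev n m"
  using assms num_univalent_eq[of "fst m" n "snd m"]
  by (auto simp: maps13_eq all_pairs_def cubic_perms_def dev_def)

lemma mean_univalent_dev:
  assumes "maps13 n \<noteq> {}"
  shows "mean_univalent n = cbrt2n n + 1 + avg (maps13 n) (dev n)"
proof -
  have "mean_univalent n = avg (maps13 n) (\<lambda>m. (cbrt2n n + 1) + dev n m)"
    unfolding mean_univalent_def expectation_random_map13[OF assms]
    by (rule avg_cong) (rule num_univalent_dev)
  then show ?thesis
    by (simp only: avg_add[where f = "\<lambda>_. cbrt2n n + 1"] avg_const[OF finite_maps13 assms])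
qed

text \<open>The variance ignores the deterministic shift \<open>cbrt2n n + 1\<close>. The squared
  mean of \<open>dev\<close> is negligible against \<open>cbrt2n n\<close>.\<close>

lemma var_univalent_dev:
  assumes "maps13 n \<noteq> {}"
  shows "var_univalent n = avg (maps13 n) (\<lambda>m. (dev n m)\<^sup>2) - (avg (maps13 n) (dev n))\<^sup>2"
proof -
  let ?d = "avg (maps13 n) (dev n)"
  have "var_univalent n = avg (maps13 n) (\<lambda>m. (real (num_univalent n m) - mean_univalent n)\<^sup>2)"
    unfolding var_univalent_def mean_univalent_def expectation_random_map13[OF assms] ..
  also have "\<dots> = avg (maps13 n) (\<lambda>m. (dev n m)\<^sup>2 - (2 * ?d * dev n m - ?d\<^sup>2))"
    by (rule avg_cong)
       (simp add: num_univalent_dev mean_univalent_dev[OF assms] power2_eq_square algebra_simps)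
  also have "\<dots> = avg (maps13 n) (\<lambda>m. (dev n m)\<^sup>2) - (2 * ?d * ?d - ?d\<^sup>2)"
    by (simp only: avg_diff avg_mult_left avg_const[OF finite_maps13 assms])
  finally show ?thesis by (simp add: power2_eq_square)
qed

lemma mean_univalent_asymp: "mean_univalent \<sim>[at_top] cbrt2n"
proof (rule asymp_equivI')
  have "(\<lambda>n. 1 + 1 / cbrt2n n + avg (maps13 n) (dev n) / sqrt (cbrt2n n) * (1 / sqrt (cbrt2n n))) \<longlonglongrightarrow> 1 + 0 + 0 * 0"
    by (intro tendsto_intros inverse_cbrt2n_limits avg_dev_limit)
  then have "(\<lambda>n. 1 + 1 / cbrt2n n + avg (maps13 n) (dev n) / sqrt (cbrt2n n) * (1 / sqrt (cbrt2n n))) \<longlonglongrightarrow> 1"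
    by simp
  moreover have "\<forall>\<^sub>F n in sequentially. 1 + 1 / cbrt2n n + avg (maps13 n) (dev n) / sqrt (cbrt2n n) * (1 / sqrt (cbrt2n n))
      = mean_univalent n / cbrt2n n"
    using eventually_ge_at_top[of 1] eventually_maps13_nonempty
  proof eventually_elim
    case (elim n)
    then show ?case
      using cbrt2n_pos[of n] by (simp add: mean_univalent_dev add_divide_distrib)
  qed
  ultimately show "(\<lambda>n. mean_univalent n / cbrt2n n) \<longlonglongrightarrow> 1"
    by (rule Lim_transform_eventually)
qed

lemma var_univalent_asymp: "var_univalent \<sim>[at_top] cbrt2n"
proof (rule asymp_equivI')
  have "(\<lambda>n. avg (maps13 n) (\<lambda>m. (dev n m)\<^sup>2) / cbrt2n n - (avg (maps13 n) (dev n) / sqrt (cbrt2n n))\<^sup>2) \<longlonglongrightarrow> 1 - 0\<^sup>2"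
    by (intro tendsto_intros avg_dev_limit avg_dev_squared_limit)
  then have "(\<lambda>n. avg (maps13 n) (\<lambda>m. (dev n m)\<^sup>2) / cbrt2n n - (avg (maps13 n) (dev n) / sqrt (cbrt2n n))\<^sup>2) \<longlonglongrightarrow> 1"
    by simp
  moreover have "\<forall>\<^sub>F n in sequentially. avg (maps13 n) (\<lambda>m. (dev n m)\<^sup>2) / cbrt2n n - (avg (maps13 n) (dev n) / sqrt (cbrt2n n))\<^sup>2
      = var_univalent n / cbrt2n n"
    using eventually_ge_at_top[of 1] eventually_maps13_nonempty
  proof eventually_elim
    case (elim n)
    then show ?case
      using cbrt2n_pos[of n] by (simp add: var_univalent_dev diff_divide_distrib power_divide)
  qed
  ultimately show "(\<lambda>n. var_univalent n / cbrt2n n) \<longlonglongrightarrow> 1"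
    by (rule Lim_transform_eventually)
qed

lemma num_univalent_weak_conv:
  "weak_conv_m
    (\<lambda>n. distr (measure_pmf (random_map13 n)) borel (\<lambda>m. (real (num_univalent n m) - cbrt2n n) / sqrt (cbrt2n n)))
    std_normal_distribution"
proof (rule levy_continuity)
  show "real_distribution (distr (measure_pmf (random_map13 n)) borel
      (\<lambda>m. (real (num_univalent n m) - cbrt2n n) / sqrt (cbrt2n n)))" for n
    by (intro prob_space.real_distribution_distr measure_pmf.prob_space_axioms) simp
  show "real_distribution std_normal_distribution"
    by (rule real_dist_normal_dist)
  fix t :: real
  \<comment> \<open>The theorem centres at \<open>cbrt2n n\<close>, while \<open>dev\<close> centres
    at \<open>cbrt2n n + 1\<close>; the discrepancy is a phase factor tending to 1.\<close>
  have "(\<lambda>n. iexp (t * (1 / sqrt (cbrt2n n))) * avg (maps13 n) (\<lambda>m. iexp (t * (dev n m / sqrt (cbrt2n n)))))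
      \<longlonglongrightarrow> iexp (t * 0) * of_real (exp (- (t\<^sup>2) / 2))"
    by (intro tendsto_intros avg_iexp_limit inverse_cbrt2n_limits)
  then have "(\<lambda>n. iexp (t * (1 / sqrt (cbrt2n n))) * avg (maps13 n) (\<lambda>m. iexp (t * (dev n m / sqrt (cbrt2n n)))))
      \<longlonglongrightarrow> char std_normal_distribution t"
    by (simp add: char_std_normal_distribution)
  moreover have "\<forall>\<^sub>F n in sequentially.
      iexp (t * (1 / sqrt (cbrt2n n))) * avg (maps13 n) (\<lambda>m. iexp (t * (dev n m / sqrt (cbrt2n n)))) =
      char (distr (measure_pmf (random_map13 n)) borel (\<lambda>m. (real (num_univalent n m) - cbrt2n n) / sqrt (cbrt2n n))) t"
    using eventually_maps13_nonempty
  proof eventually_elim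
    case (elim n)
    have "char (distr (measure_pmf (random_map13 n)) borel (\<lambda>m. (real (num_univalent n m) - cbrt2n n) / sqrt (cbrt2n n))) t =
        avg (maps13 n) (\<lambda>m. iexp (t * ((real (num_univalent n m) - cbrt2n n) / sqrt (cbrt2n n))))"
      unfolding char_def by (subst integral_distr) (simp_all add: expectation_random_map13[OF elim])
    also have "\<dots> = avg (maps13 n) (\<lambda>m. iexp (t * (1 / sqrt (cbrt2n n))) * iexp (t * (dev n m / sqrt (cbrt2n n))))"
      by (rule avg_cong)
         (simp add: num_univalent_dev add_divide_distrib distrib_left exp_add[symmetric])
    finally show ?case by (simp only: avg_mult_left)
  qed
  ultimately show "(\<lambda>n. char (distr (measure_pmf (random_map13 n)) borel
      (\<lambda>m. (real (num_univalent n m) - cbrt2n n) / sqrt (cbrt2n n))) t) \<longlonglongrightarrow> char std_normal_distribution t"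
    by (rule Lim_transform_eventually)
qed

theorem mainTheorem3:
  shows "mean_univalent \<sim>[at_top] var_univalent \<and>
    var_univalent \<sim>[at_top] (\<lambda>n. root 3 (2 * real n)) \<and>
    mean_univalent \<sim>[at_top] (\<lambda>n. root 3 (2 * real n)) \<and>
    weak_conv_m
      (\<lambda>n. distr (measure_pmf (random_map13 n)) borel
        (\<lambda>m. (real (num_univalent n m) - root 3 (2 * real n)) / sqrt (root 3 (2 * real n))))
      std_normal_distribution"
  using mean_univalent_asymp var_univalent_asymp num_univalent_weak_conv
    asymp_equiv_trans[OF mean_univalent_asymp asymp_equiv_symI[OF var_univalent_asymp]]
  unfolding cbrt2n_def by blast

end
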